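(* The assignment $\mathfrak{P}:\mathbf{Alg}_{\nabla}(D)\to\mathbf{K}^{op}$ is a functor, and for every distributive $\nabla$-algebra $\mathcal{A}$ the map $i_{\mathcal{A}}:\mathcal{A}\to\mathfrak{U}\mathfrak{P}(\mathcal{A})$ is a $\nabla$-algebra embedding, natural in $\mathcal{A}$. Moreover, for any $C\subseteq\{N,R,L,Fa,Fu\}$, if $\mathcal{A}\in\mathbf{Alg}_{\nabla}(C,D)$, then $\mathfrak{P}(\mathcal{A})$ lies in $[\mathbf{K}(C)]^{op}$. Furthermore, $\mathfrak{P}$ maps $\mathbf{Alg}^H_{\nabla}(C)$ to $[\mathbf{K}^H(C)]^{op}$, and there $i_{\mathcal{A}}$ is a Heyting $\nabla$-algebra morphism.
   Context: $\nabla$-algebras. A $\nabla$-algebra is a tuple $\mathcal{A}=(\mathsf{A},\nabla,\to)$ where $\mathsf{A}=(A,\wedge,\vee,0,1)$ is a bounded lattice, $\nabla$ is unary and $\to$ binary on $A$, with $\nabla c\wedge a\leq b$ iff $c\leq a\to b$ for all $a,b,c\in A$. $\Box a:=1\to a$. Conditions: $(D)$ $\mathsf{A}$ is distributive; $(N)$ $\nabla$ preserves all finite meets (including $\nabla1=1$); $(R)$ $a\leq\nabla a$ for all $a$; $(L)$ $\nabla a\leq a$ for all $a$; $(Fa)$ $\nabla$ is surjective; $(Fu)$ $\Box$ is surjective. A $\nabla$-algebra morphism is a bounded lattice morphism preserving $\nabla$ and $\to$; it is an embedding if injective. $\mathbf{Alg}_\nabla(C,D)$ is the category of distributive $\nabla$-algebras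 satisfying all conditions in $C$, with $\nabla$-algebra morphisms; $\mathbf{Alg}_\nabla(D)$ is the case $C=\varnothing$. $\mathbf{Alg}^H_\nabla(C)$ is the category of explicitly Heyting $\nabla$-algebras $(\mathsf{A},\nabla,\to,\supset)$ ($\supset$ the Heyting implication of $\mathsf{A}$) satisfying $C$, with Heyting $\nabla$-algebra morphisms, i.e., $\nabla$-algebra morphisms also preserving $\supset$. Kripke frames. A Kripke frame is $\mathcal{K}=(W,\leq,R)$ with $(W,\leq)$ a poset and $R\subseteq W^2$ such that $k'\leq k$, $(k,l)\in R$, $l\leq l'$ imply $(k',l')\in R$. Conditions: $(N)$ there is an order-preserving $\pi:W\to W$ with $(x,y)\in R$ iff $x\leq\pi(y)$; $(R)$ $R$ is reflexive; $(L)$ $R\subseteq\ \leq$; $(Fa)$ for any $x\in W$ there is $y\in W$ with $(y,x)\in R$ and such that for all $z$, $(y,z)\in R$ implies $x\leq z$; $(Fu)$ for any $x\in W$ there is $y\in W$ with $(x,y)\in R$ and such that for all $z$, $(z,y)\in R$ implies $z\leq x$. A Kripke morphism $f:(W,\leq,R)\to(W',\leq',R')$ is an order-preserving map such that: $(k,l)\in R$ implies $(f(k),f(l))\in R'$; if $(f(k),l')\in R'$ then there is $l\in W$ with $(k,l)\in R$ and $f(l)=l'$; if $(l',f(k))\in R'$ then there is $l\in W$ with $(l,k)\in R$ and $f(l)\geq' l'$. It is Heyting if moreover $f(k)\leq' l'$ implies there is $l\geq k$ with $f(l)=l'$. $\mathbf{K}(C)$ is the category of Kripke frames satisfying the conditions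 in $C$ with Kripke morphisms ($\mathbf{K}=\mathbf{K}(\varnothing)$); $\mathbf{K}^H(C)$ uses Heyting Kripke morphisms instead. The functor $\mathfrak{U}$. For $\mathcal{K}=(W,\leq,R)$, $\mathfrak{U}(\mathcal{K})=(U(W,\leq),\nabla_{\mathcal{K}},\to_{\mathcal{K}})$, where $U(W,\leq)$ is the lattice of upsets, $\nabla_{\mathcal{K}}U=\{x\in W\mid\exists y\in U,\ (y,x)\in R\}$, $U\to_{\mathcal{K}}V=\{x\in W\mid\forall y\in U,\ [(x,y)\in R\Rightarrow y\in V]\}$ (with the usual Heyting implication of upsets added in the explicitly Heyting case); and $\mathfrak{U}(f)=f^{-1}$. The assignment $\mathfrak{P}$. A filter is an upset closed under all finite meets; a filter $P$ is prime if $0\notin P$ and $a\vee b\in P$ implies $a\in P$ or $b\in P$. For a distributive $\nabla$-algebra $\mathcal{A}$, $\mathfrak{P}(\mathcal{A})=(\mathcal{F}_p(\mathsf{A}),\subseteq,R_{\mathcal{A}})$, where $\mathcal{F}_p(\mathsf{A})$ is the set of prime filters and $(P,Q)\in R_{\mathcal{A}}$ iff for all $a,b\in A$, $a\to b\in P$ and $a\in Q$ imply $b\in Q$. For a $\nabla$-algebra morphism $f:\mathcal{A}\to\mathcal{B}$, $\mathfrak{P}(f)=f^{-1}:\mathfrak{P}(\mathcal{B})\to\mathfrak{P}(\mathcal{A})$. The map $i_{\mathcal{A}}$ is $i_{\mathcal{A}}(a)=\{P\in\mathcal{F}_p(\mathsf{A})\mid a\in P\}$. Naturality means $\mathfrak{U}\mathfrak{P}(f)\circ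 i_{\mathcal{A}}=i_{\mathcal{B}}\circ f$ for every morphism $f:\mathcal{A}\to\mathcal{B}$. *)

theory Defs
  imports "HOL-Algebra.Lattice" "HOL-Library.FuncSet"
begin

section \<open>Categories and functors\<close>

text \<open>
  Composition takes the source, middle and target objects as arguments, since arrows are
  plain functions that do not record their source and target: \<open>cat_comp C X Y Z g f\<close> is
  \<open>g\<close> after \<open>f\<close> for \<open>f\<close> from \<open>X\<close> to \<open>Y\<close> and \<open>g\<close> from \<open>Y\<close> to \<open>Z\<close>.
\<close>

record ('o, 'm) cat =
  cat_ob :: "'o set"
  cat_hom :: "'o \<Rightarrow> 'o \<Rightarrow> 'm set"
  cat_id :: "'o \<Rightarrow> 'm"
  cat_comp :: "'o \<Rightarrow> 'o \<Rightarrow> 'o \<Rightarrow> 'm \<Rightarrow> 'm \<Rightarrow> 'm"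

definition is_category :: "('o, 'm) cat \<Rightarrow> bool" where
  "is_category C \<longleftrightarrow>
     (\<forall>X\<in>cat_ob C. cat_id C X \<in> cat_hom C X X) \<and>
     (\<forall>X\<in>cat_ob C. \<forall>Y\<in>cat_ob C. \<forall>Z\<in>cat_ob C. \<forall>f\<in>cat_hom C X Y. \<forall>g\<in>cat_hom C Y Z.
        cat_comp C X Y Z g f \<in> cat_hom C X Z) \<and>
     (\<forall>X\<in>cat_ob C. \<forall>Y\<in>cat_ob C. \<forall>f\<in>cat_hom C X Y.
        cat_comp C X X Y f (cat_id C X) = f \<and> cat_comp C X Y Y (cat_id C Y) f = f) \<and>
     (\<forall>X\<in>cat_ob C. \<forall>Y\<in>cat_ob C. \<forall>Z\<in>cat_ob C. \<forall>T\<in>cat_ob C.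
        \<forall>f\<in>cat_hom C X Y. \<forall>g\<in>cat_hom C Y Z. \<forall>h\<in>cat_hom C Z T.
        cat_comp C X Z T h (cat_comp C X Y Z g f) = cat_comp C X Y T (cat_comp C Y Z T h g) f)"

definition opposite :: "('o, 'm) cat \<Rightarrow> ('o, 'm) cat" where
  "opposite C =
     \<lparr>cat_ob = cat_ob C,
      cat_hom = (\<lambda>X Y. cat_hom C Y X),
      cat_id = cat_id C,
      cat_comp = (\<lambda>X Y Z g f. cat_comp C Z Y X f g)\<rparr>"

definition is_functor ::
  "('o, 'm) cat \<Rightarrow> ('p, 'n) cat \<Rightarrow> ('o \<Rightarrow> 'p) \<Rightarrow> ('o \<Rightarrow> 'o \<Rightarrow> 'm \<Rightarrow> 'n) \<Rightarrow> bool" where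
  "is_functor C D F\<^sub>o F\<^sub>m \<longleftrightarrow>
     is_category C \<and> is_category D \<and>
     (\<forall>X\<in>cat_ob C. F\<^sub>o X \<in> cat_ob D) \<and>
     (\<forall>X\<in>cat_ob C. \<forall>Y\<in>cat_ob C. \<forall>f\<in>cat_hom C X Y.
        F\<^sub>m X Y f \<in> cat_hom D (F\<^sub>o X) (F\<^sub>o Y)) \<and>
     (\<forall>X\<in>cat_ob C. F\<^sub>m X X (cat_id C X) = cat_id D (F\<^sub>o X)) \<and>
     (\<forall>X\<in>cat_ob C. \<forall>Y\<in>cat_ob C. \<forall>Z\<in>cat_ob C. \<forall>f\<in>cat_hom C X Y. \<forall>g\<in>cat_hom C Y Z.
        F\<^sub>m X Z (cat_comp C X Y Z g f) =
          cat_comp D (F\<^sub>o X) (F\<^sub>o Y) (F\<^sub>o Z) (F\<^sub>m Y Z g) (F\<^sub>m X Y f))"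

datatype condition = Cond_N | Cond_R | Cond_L | Cond_Fa | Cond_Fu


section \<open>Algebras\<close>

record 'a nabla_algebra = "'a gorder" +
  nabla :: "'a \<Rightarrow> 'a"
  arrow :: "'a \<Rightarrow> 'a \<Rightarrow> 'a"

record 'a heyting_nabla_algebra = "'a nabla_algebra" +
  himp :: "'a \<Rightarrow> 'a \<Rightarrow> 'a"

locale nabla_algebra = bounded_lattice A
  for A :: "('a, 'm) nabla_algebra_scheme" (structure) +
  assumes nabla_closed: "a \<in> carrier A \<Longrightarrow> nabla A a \<in> carrier A"
    and arrow_closed: "\<lbrakk>a \<in> carrier A; b \<in> carrier A\<rbrakk> \<Longrightarrow> arrow A a b \<in> carrier A"
    and nabla_arrow: "\<lbrakk>a \<in> carrier A; b \<in> carrier A; c \<in> carrier A\<rbrakk> \<Longrightarrow>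
      nabla A c \<sqinter> a \<sqsubseteq> b \<longleftrightarrow> c \<sqsubseteq> arrow A a b"

locale distributive_nabla_algebra = nabla_algebra +
  assumes distrib: "\<lbrakk>a \<in> carrier A; b \<in> carrier A; c \<in> carrier A\<rbrakk> \<Longrightarrow>
      a \<sqinter> (b \<squnion> c) = (a \<sqinter> b) \<squnion> (a \<sqinter> c)"

text \<open>Distributivity is a consequence of the residuation law for \<open>himp\<close>.\<close>

locale heyting_nabla_algebra = nabla_algebra A
  for A :: "('a, 'm) heyting_nabla_algebra_scheme" (structure) +
  assumes himp_closed: "\<lbrakk>a \<in> carrier A; b \<in> carrier A\<rbrakk> \<Longrightarrow> himp A a b \<in> carrier A"
    and himp_residuation: "\<lbrakk>a \<in> carrier A; b \<in> carrier A; c \<in> carrier A\<rbrakk> \<Longrightarrow>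
      c \<sqinter> a \<sqsubseteq> b \<longleftrightarrow> c \<sqsubseteq> himp A a b"

definition box :: "('a, 'm) nabla_algebra_scheme \<Rightarrow> 'a \<Rightarrow> 'a" where
  "box A a = arrow A \<top>\<^bsub>A\<^esub> a"

fun alg_cond :: "('a, 'm) nabla_algebra_scheme \<Rightarrow> condition \<Rightarrow> bool" where
  "alg_cond A Cond_N \<longleftrightarrow> nabla A \<top>\<^bsub>A\<^esub> = \<top>\<^bsub>A\<^esub> \<and>
     (\<forall>a\<in>carrier A. \<forall>b\<in>carrier A. nabla A (a \<sqinter>\<^bsub>A\<^esub> b) = nabla A a \<sqinter>\<^bsub>A\<^esub> nabla A b)"
| "alg_cond A Cond_R \<longleftrightarrow> (\<forall>a\<in>carrier A. a \<sqsubseteq>\<^bsub>A\<^esub> nabla A a)"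
| "alg_cond A Cond_L \<longleftrightarrow> (\<forall>a\<in>carrier A. nabla A a \<sqsubseteq>\<^bsub>A\<^esub> a)"
| "alg_cond A Cond_Fa \<longleftrightarrow> nabla A ` carrier A = carrier A"
| "alg_cond A Cond_Fu \<longleftrightarrow> box A ` carrier A = carrier A"

text \<open>Morphisms are extensional functions, so that equality in a hom-set is equality on the carrier.\<close>

definition nabla_hom ::
  "('a, 'm) nabla_algebra_scheme \<Rightarrow> ('b, 'n) nabla_algebra_scheme \<Rightarrow> ('a \<Rightarrow> 'b) set" where
  "nabla_hom A B =
     {f \<in> carrier A \<rightarrow>\<^sub>E carrier B.
        meet_pres A B f \<and> join_pres A B f \<and>
        f \<top>\<^bsub>A\<^esub> = \<top>\<^bsub>B\<^esub> \<and> f \<bottom>\<^bsub>A\<^esub> = \<bottom>\<^bsub>B\<^esub> \<and>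
        (\<forall>a\<in>carrier A. f (nabla A a) = nabla B (f a)) \<and>
        (\<forall>a\<in>carrier A. \<forall>b\<in>carrier A. f (arrow A a b) = arrow B (f a) (f b))}"

definition nabla_embedding ::
  "('a, 'm) nabla_algebra_scheme \<Rightarrow> ('b, 'n) nabla_algebra_scheme \<Rightarrow> ('a \<Rightarrow> 'b) set" where
  "nabla_embedding A B = {f \<in> nabla_hom A B. inj_on f (carrier A)}"

definition heyting_nabla_hom ::
  "('a, 'm) heyting_nabla_algebra_scheme \<Rightarrow> ('b, 'n) heyting_nabla_algebra_scheme \<Rightarrow> ('a \<Rightarrow> 'b) set"
  where
  "heyting_nabla_hom A B =
     {f \<in> nabla_hom A B. \<forall>a\<in>carrier A. \<forall>b\<in>carrier A. f (himp A a b) = himp B (f a) (f b)}"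

text \<open>Distributivity is built in: \<open>Alg_nabla C\<close> is the category of algebras satisfying \<open>C\<close> and (D).\<close>

definition Alg_nabla :: "condition set \<Rightarrow> ('a nabla_algebra, 'a \<Rightarrow> 'a) cat" where
  "Alg_nabla C =
     \<lparr>cat_ob = {A. distributive_nabla_algebra A \<and> (\<forall>c\<in>C. alg_cond A c)},
      cat_hom = nabla_hom,
      cat_id = (\<lambda>A. \<lambda>a\<in>carrier A. a),
      cat_comp = (\<lambda>A B D g f. compose (carrier A) g f)\<rparr>"

definition Alg_nabla_H :: "condition set \<Rightarrow> ('a heyting_nabla_algebra, 'a \<Rightarrow> 'a) cat" where
  "Alg_nabla_H C =
     \<lparr>cat_ob = {A. heyting_nabla_algebra A \<and> (\<forall>c\<in>C. alg_cond A c)},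
      cat_hom = heyting_nabla_hom,
      cat_id = (\<lambda>A. \<lambda>a\<in>carrier A. a),
      cat_comp = (\<lambda>A B D g f. compose (carrier A) g f)\<rparr>"


section \<open>Kripke frames\<close>

record 'w kripke_frame = "'w gorder" +
  acc :: "('w \<times> 'w) set"

locale kripke_frame = partial_order K
  for K :: "('w, 'm) kripke_frame_scheme" (structure) +
  assumes acc_subset: "acc K \<subseteq> carrier K \<times> carrier K"
    and acc_compat: "\<lbrakk>k' \<in> carrier K; l' \<in> carrier K; k' \<sqsubseteq> k; (k, l) \<in> acc K; l \<sqsubseteq> l'\<rbrakk> \<Longrightarrow>
      (k', l') \<in> acc K"

fun frame_cond :: "('w, 'm) kripke_frame_scheme \<Rightarrow> condition \<Rightarrow> bool" where
  "frame_cond K Cond_N \<longleftrightarrow>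
     (\<exists>\<pi>\<in>carrier K \<rightarrow> carrier K. isotone K K \<pi> \<and>
        (\<forall>x\<in>carrier K. \<forall>y\<in>carrier K. (x, y) \<in> acc K \<longleftrightarrow> x \<sqsubseteq>\<^bsub>K\<^esub> \<pi> y))"
| "frame_cond K Cond_R \<longleftrightarrow> (\<forall>x\<in>carrier K. (x, x) \<in> acc K)"
| "frame_cond K Cond_L \<longleftrightarrow> (\<forall>(x, y)\<in>acc K. x \<sqsubseteq>\<^bsub>K\<^esub> y)"
| "frame_cond K Cond_Fa \<longleftrightarrow>
     (\<forall>x\<in>carrier K. \<exists>y\<in>carrier K. (y, x) \<in> acc K \<and>
        (\<forall>z\<in>carrier K. (y, z) \<in> acc K \<longrightarrow> x \<sqsubseteq>\<^bsub>K\<^esub> z))"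
| "frame_cond K Cond_Fu \<longleftrightarrow>
     (\<forall>x\<in>carrier K. \<exists>y\<in>carrier K. (x, y) \<in> acc K \<and>
        (\<forall>z\<in>carrier K. (z, y) \<in> acc K \<longrightarrow> z \<sqsubseteq>\<^bsub>K\<^esub> x))"

definition kripke_hom ::
  "('w, 'm) kripke_frame_scheme \<Rightarrow> ('v, 'n) kripke_frame_scheme \<Rightarrow> ('w \<Rightarrow> 'v) set" where
  "kripke_hom K K' =
     {f \<in> carrier K \<rightarrow>\<^sub>E carrier K'.
        isotone K K' f \<and>
        (\<forall>(k, l)\<in>acc K. (f k, f l) \<in> acc K') \<and>
        (\<forall>k\<in>carrier K. \<forall>l'\<in>carrier K'. (f k, l') \<in> acc K' \<longrightarrow>
           (\<exists>l\<in>carrier K. (k, l) \<in> acc K \<and> f l = l')) \<and>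
        (\<forall>k\<in>carrier K. \<forall>l'\<in>carrier K'. (l', f k) \<in> acc K' \<longrightarrow>
           (\<exists>l\<in>carrier K. (l, k) \<in> acc K \<and> l' \<sqsubseteq>\<^bsub>K'\<^esub> f l))}"

definition heyting_kripke_hom ::
  "('w, 'm) kripke_frame_scheme \<Rightarrow> ('v, 'n) kripke_frame_scheme \<Rightarrow> ('w \<Rightarrow> 'v) set" where
  "heyting_kripke_hom K K' =
     {f \<in> kripke_hom K K'.
        \<forall>k\<in>carrier K. \<forall>l'\<in>carrier K'. f k \<sqsubseteq>\<^bsub>K'\<^esub> l' \<longrightarrow>
          (\<exists>l\<in>carrier K. k \<sqsubseteq>\<^bsub>K\<^esub> l \<and> f l = l')}"

definition Kripke :: "condition set \<Rightarrow> ('w kripke_frame, 'w \<Rightarrow> 'w) cat" where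
  "Kripke C =
     \<lparr>cat_ob = {K. kripke_frame K \<and> (\<forall>c\<in>C. frame_cond K c)},
      cat_hom = kripke_hom,
      cat_id = (\<lambda>K. \<lambda>k\<in>carrier K. k),
      cat_comp = (\<lambda>K L M g f. compose (carrier K) g f)\<rparr>"

definition Kripke_H :: "condition set \<Rightarrow> ('w kripke_frame, 'w \<Rightarrow> 'w) cat" where
  "Kripke_H C =
     \<lparr>cat_ob = {K. kripke_frame K \<and> (\<forall>c\<in>C. frame_cond K c)},
      cat_hom = heyting_kripke_hom,
      cat_id = (\<lambda>K. \<lambda>k\<in>carrier K. k),
      cat_comp = (\<lambda>K L M g f. compose (carrier K) g f)\<rparr>"


section \<open>From Kripke frames to algebras\<close>

definition upsets :: "('w, 'm) gorder_scheme \<Rightarrow> 'w set set" where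
  "upsets K = {U. U \<subseteq> carrier K \<and> (\<forall>x\<in>U. \<forall>y\<in>carrier K. x \<sqsubseteq>\<^bsub>K\<^esub> y \<longrightarrow> y \<in> U)}"

definition upset_nabla :: "('w, 'm) kripke_frame_scheme \<Rightarrow> 'w set \<Rightarrow> 'w set" where
  "upset_nabla K U = {x \<in> carrier K. \<exists>y\<in>U. (y, x) \<in> acc K}"

definition upset_arrow :: "('w, 'm) kripke_frame_scheme \<Rightarrow> 'w set \<Rightarrow> 'w set \<Rightarrow> 'w set" where
  "upset_arrow K U V = {x \<in> carrier K. \<forall>y\<in>U. (x, y) \<in> acc K \<longrightarrow> y \<in> V}"

definition upset_himp :: "('w, 'm) gorder_scheme \<Rightarrow> 'w set \<Rightarrow> 'w set \<Rightarrow> 'w set" where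
  "upset_himp K U V = {x \<in> carrier K. \<forall>y\<in>U. x \<sqsubseteq>\<^bsub>K\<^esub> y \<longrightarrow> y \<in> V}"

definition upset_alg :: "('w, 'm) kripke_frame_scheme \<Rightarrow> 'w set nabla_algebra" where
  "upset_alg K =
     \<lparr>carrier = upsets K, eq = (=), le = (\<subseteq>), nabla = upset_nabla K, arrow = upset_arrow K\<rparr>"

definition upset_alg_H :: "('w, 'm) kripke_frame_scheme \<Rightarrow> 'w set heyting_nabla_algebra" where
  "upset_alg_H K =
     \<lparr>carrier = upsets K, eq = (=), le = (\<subseteq>), nabla = upset_nabla K, arrow = upset_arrow K,
      himp = upset_himp K\<rparr>"

text \<open>The preimage map on upsets induced by \<open>f\<close> from \<open>K\<close> to \<open>L\<close>.\<close>

definition upset_map ::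
  "('w, 'm) kripke_frame_scheme \<Rightarrow> ('v, 'n) kripke_frame_scheme \<Rightarrow> ('w \<Rightarrow> 'v) \<Rightarrow> 'v set \<Rightarrow> 'w set"
  where
  "upset_map K L f = (\<lambda>U\<in>upsets L. f -` U \<inter> carrier K)"


section \<open>From algebras to Kripke frames\<close>

definition is_filter :: "('a, 'm) gorder_scheme \<Rightarrow> 'a set \<Rightarrow> bool" where
  "is_filter A F \<longleftrightarrow> F \<in> upsets A \<and> \<top>\<^bsub>A\<^esub> \<in> F \<and> (\<forall>a\<in>F. \<forall>b\<in>F. a \<sqinter>\<^bsub>A\<^esub> b \<in> F)"

definition prime_filters :: "('a, 'm) gorder_scheme \<Rightarrow> 'a set set" where
  "prime_filters A =
     {P. is_filter A P \<and> \<bottom>\<^bsub>A\<^esub> \<notin> P \<and>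
         (\<forall>a\<in>carrier A. \<forall>b\<in>carrier A. a \<squnion>\<^bsub>A\<^esub> b \<in> P \<longrightarrow> a \<in> P \<or> b \<in> P)}"

definition prime_acc :: "('a, 'm) nabla_algebra_scheme \<Rightarrow> ('a set \<times> 'a set) set" where
  "prime_acc A =
     {(P, Q). P \<in> prime_filters A \<and> Q \<in> prime_filters A \<and>
        (\<forall>a\<in>carrier A. \<forall>b\<in>carrier A. arrow A a b \<in> P \<and> a \<in> Q \<longrightarrow> b \<in> Q)}"

definition prime_frame :: "('a, 'm) nabla_algebra_scheme \<Rightarrow> 'a set kripke_frame" where
  "prime_frame A = \<lparr>carrier = prime_filters A, eq = (=), le = (\<subseteq>), acc = prime_acc A\<rparr>"

text \<open>The preimage map on prime filters induced by \<open>f\<close> from \<open>A\<close> to \<open>B\<close>.\<close>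

definition prime_map ::
  "('a, 'm) nabla_algebra_scheme \<Rightarrow> ('b, 'n) nabla_algebra_scheme \<Rightarrow> ('a \<Rightarrow> 'b) \<Rightarrow> 'b set \<Rightarrow> 'a set"
  where
  "prime_map A B f = (\<lambda>Q\<in>prime_filters B. f -` Q \<inter> carrier A)"

definition prime_embed :: "('a, 'm) nabla_algebra_scheme \<Rightarrow> 'a \<Rightarrow> 'a set set" where
  "prime_embed A = (\<lambda>a\<in>carrier A. {P \<in> prime_filters A. a \<in> P})"

end

theory Submission
  imports Defs
begin

text \<open>
  Since \<open>nabla\<close> is left adjoint to \<open>box\<close>, the relation on prime filters can be rewritten as
  \<open>(P, Q) \<in> prime_acc A\<close> iff \<open>nabla\<close> maps \<open>P\<close> into \<open>Q\<close>. Every prime filter demanded by the theorem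
  (the lifting conditions for Kripke morphisms, the frame conditions (Fa) and (Fu), and the fact that
  \<open>prime_embed\<close> is injective and preserves \<open>nabla\<close>, \<open>arrow\<close> and \<open>himp\<close>) is then obtained from one
  separation principle: a down-directed set \<open>S\<close> and an up-directed set \<open>T\<close> such that no element of
  \<open>S\<close> lies below an element of \<open>T\<close> are separated by a prime filter. The directed sets used are images
  of filters and of complements of prime filters under monotone maps, pairwise meets of such sets, and
  the sets of all \<open>a\<close> with \<open>nabla A a \<notin> P\<close>, which are up-directed because \<open>nabla\<close> preserves joins.
\<close>

section \<open>Directed sets and prime filters\<close>

text \<open>The obstacle is that \<open>nabla\<close> need not preserve meets. Without (N) the set
  of all \<open>a\<close> with \<open>nabla A a \<in> Q\<close> need not be a filter, so a prime
  filter related to \<open>Q\<close> cannot simply be written down as a preimage; it has to be found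
  by maximality. Directedness is the property that survives: monotone maps preserve it in both
  directions, so images can be fed to the separation principle as they stand, with no generated
  filter or ideal to describe. The choice of \<open>S\<close> and \<open>T\<close> can be read off
  from the filter \<open>Q\<close> that is wanted. The demand
  \<open>(P, Q) \<in> prime_acc A\<close> is about what \<open>Q\<close> must contain and goes into
  \<open>S\<close>; the demand \<open>(Q, P) \<in> prime_acc A\<close> is about what
  \<open>Q\<close> must avoid and goes into \<open>T\<close>. Requiring the preimage of
  \<open>Q\<close> under a morphism to equal a given \<open>Q'\<close> contributes to both sides,
  whereas requiring it only to contain \<open>Q'\<close> contributes to \<open>S\<close> alone. In
  each case a failure of separation is an inequality which an adjunction, or monotonicity, turns
  into a membership already excluded.\<close>

definition down_directed :: "('a, 'm) gorder_scheme \<Rightarrow> 'a set \<Rightarrow> bool" where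
  "down_directed L S \<longleftrightarrow> S \<subseteq> carrier L \<and> S \<noteq> {} \<and>
     (\<forall>s\<in>S. \<forall>t\<in>S. \<exists>u\<in>S. u \<sqsubseteq>\<^bsub>L\<^esub> s \<and> u \<sqsubseteq>\<^bsub>L\<^esub> t)"

definition up_directed :: "('a, 'm) gorder_scheme \<Rightarrow> 'a set \<Rightarrow> bool" where
  "up_directed L T \<longleftrightarrow> T \<subseteq> carrier L \<and> T \<noteq> {} \<and>
     (\<forall>s\<in>T. \<forall>t\<in>T. \<exists>u\<in>T. s \<sqsubseteq>\<^bsub>L\<^esub> u \<and> t \<sqsubseteq>\<^bsub>L\<^esub> u)"

definition up_closure :: "('a, 'm) gorder_scheme \<Rightarrow> 'a set \<Rightarrow> 'a set" where
  "up_closure L S = {y \<in> carrier L. \<exists>s\<in>S. s \<sqsubseteq>\<^bsub>L\<^esub> y}"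

lemma is_filterD:
  assumes "is_filter A F"
  shows is_filter_carrier: "a \<in> F \<Longrightarrow> a \<in> carrier A"
    and is_filter_up: "a \<in> F \<Longrightarrow> b \<in> carrier A \<Longrightarrow> a \<sqsubseteq>\<^bsub>A\<^esub> b \<Longrightarrow> b \<in> F"
    and is_filter_top: "\<top>\<^bsub>A\<^esub> \<in> F"
    and is_filter_meet: "a \<in> F \<Longrightarrow> b \<in> F \<Longrightarrow> a \<sqinter>\<^bsub>A\<^esub> b \<in> F"
proof -
  have F: "F \<in> upsets A" "\<top>\<^bsub>A\<^esub> \<in> F" "\<forall>a\<in>F. \<forall>b\<in>F. a \<sqinter>\<^bsub>A\<^esub> b \<in> F"
    using assms by (simp_all add: is_filter_def)
  show "a \<in> F \<Longrightarrow> a \<in> carrier A"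
    using F(1) unfolding upsets_def by blast
  show "a \<in> F \<Longrightarrow> b \<in> carrier A \<Longrightarrow> a \<sqsubseteq>\<^bsub>A\<^esub> b \<Longrightarrow> b \<in> F"
    using F(1) unfolding upsets_def by blast
qed (use assms in \<open>simp_all add: is_filter_def\<close>)

lemma is_filterI:
  assumes "\<And>a. a \<in> F \<Longrightarrow> a \<in> carrier A"
    and "\<And>a b. a \<in> F \<Longrightarrow> b \<in> carrier A \<Longrightarrow> a \<sqsubseteq>\<^bsub>A\<^esub> b \<Longrightarrow> b \<in> F"
    and "\<top>\<^bsub>A\<^esub> \<in> F"
    and "\<And>a b. a \<in> F \<Longrightarrow> b \<in> F \<Longrightarrow> a \<sqinter>\<^bsub>A\<^esub> b \<in> F"
  shows "is_filter A F"
  unfolding is_filter_def upsets_def using assms by blast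

lemma prime_filtersD:
  assumes "P \<in> prime_filters A"
  shows prime_filter_is_filter: "is_filter A P"
    and prime_filter_carrier: "a \<in> P \<Longrightarrow> a \<in> carrier A"
    and prime_filter_up: "a \<in> P \<Longrightarrow> b \<in> carrier A \<Longrightarrow> a \<sqsubseteq>\<^bsub>A\<^esub> b \<Longrightarrow> b \<in> P"
    and prime_filter_top: "\<top>\<^bsub>A\<^esub> \<in> P"
    and prime_filter_meet: "a \<in> P \<Longrightarrow> b \<in> P \<Longrightarrow> a \<sqinter>\<^bsub>A\<^esub> b \<in> P"
    and prime_filter_bottom: "\<bottom>\<^bsub>A\<^esub> \<notin> P"
    and prime_filter_join:
      "a \<in> carrier A \<Longrightarrow> b \<in> carrier A \<Longrightarrow> a \<squnion>\<^bsub>A\<^esub> b \<in> P \<Longrightarrow> a \<in> P \<or> b \<in> P"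
proof -
  have P: "is_filter A P" "\<bottom>\<^bsub>A\<^esub> \<notin> P"
    "\<forall>a\<in>carrier A. \<forall>b\<in>carrier A. a \<squnion>\<^bsub>A\<^esub> b \<in> P \<longrightarrow> a \<in> P \<or> b \<in> P"
    using assms unfolding prime_filters_def by blast+
  show "is_filter A P" "\<bottom>\<^bsub>A\<^esub> \<notin> P"
    by (rule P)+
  show "a \<in> P \<Longrightarrow> a \<in> carrier A"
    by (rule is_filter_carrier[OF P(1)])
  show "a \<in> P \<Longrightarrow> b \<in> carrier A \<Longrightarrow> a \<sqsubseteq>\<^bsub>A\<^esub> b \<Longrightarrow> b \<in> P"
    by (rule is_filter_up[OF P(1)])
  show "\<top>\<^bsub>A\<^esub> \<in> P"
    by (rule is_filter_top[OF P(1)])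
  show "a \<in> P \<Longrightarrow> b \<in> P \<Longrightarrow> a \<sqinter>\<^bsub>A\<^esub> b \<in> P"
    by (rule is_filter_meet[OF P(1)])
  show "a \<in> carrier A \<Longrightarrow> b \<in> carrier A \<Longrightarrow> a \<squnion>\<^bsub>A\<^esub> b \<in> P \<Longrightarrow> a \<in> P \<or> b \<in> P"
    by (rule P(3)[rule_format])
qed

context bounded_lattice
begin

lemma meet_top_right: "a \<in> carrier L \<Longrightarrow> a \<sqinter> \<top> = a"
  using top_meet[of a] by (metis eq_is_equal meet_comm)

lemma meet_mono:
  assumes "a \<sqsubseteq> a'" "b \<sqsubseteq> b'"
    and "a \<in> carrier L" "a' \<in> carrier L" "b \<in> carrier L" "b' \<in> carrier L"
  shows "a \<sqinter> b \<sqsubseteq> a' \<sqinter> b'"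
proof (rule meet_le)
  show "a \<sqinter> b \<sqsubseteq> a'"
    by (rule le_trans[OF meet_left assms(1)]) (intro assms meet_closed)+
  show "a \<sqinter> b \<sqsubseteq> b'"
    by (rule le_trans[OF meet_right assms(2)]) (intro assms meet_closed)+
qed (intro assms meet_closed)+

lemma prime_filter_meet_iff:
  assumes "P \<in> prime_filters L" "a \<in> carrier L" "b \<in> carrier L"
  shows "a \<sqinter> b \<in> P \<longleftrightarrow> a \<in> P \<and> b \<in> P"
  by (metis assms meet_left meet_right prime_filter_meet prime_filter_up)

lemma prime_filter_join_iff:
  assumes "P \<in> prime_filters L" "a \<in> carrier L" "b \<in> carrier L"
  shows "a \<squnion> b \<in> P \<longleftrightarrow> a \<in> P \<or> b \<in> P"
  by (metis assms join_closed join_left join_right prime_filter_join prime_filter_up)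

lemma down_directed_filter: "is_filter L F \<Longrightarrow> down_directed L F"
  unfolding down_directed_def
proof (intro conjI ballI)
  assume F: "is_filter L F"
  show "\<exists>u\<in>F. u \<sqsubseteq> s \<and> u \<sqsubseteq> t" if "s \<in> F" "t \<in> F" for s t
    using that is_filter_carrier[OF F] is_filter_meet[OF F]
    by (intro bexI[of _ "s \<sqinter> t"]) (simp_all add: meet_left meet_right)
  show "F \<noteq> {}"
    using is_filter_top[OF F] by blast
qed (blast dest: is_filter_carrier)

lemma down_directed_singleton: "a \<in> carrier L \<Longrightarrow> down_directed L {a}"
  by (simp add: down_directed_def)

lemma up_directed_singleton: "a \<in> carrier L \<Longrightarrow> up_directed L {a}"
  by (simp add: up_directed_def)

text \<open>Serves to join two demands on one prime filter: a filter containing all these meets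
  contains both \<open>S\<close> and \<open>T\<close>, since neither is empty and filters are closed
  upwards.\<close>

lemma down_directed_meets:
  assumes S: "down_directed L S" and T: "down_directed L T"
  shows "down_directed L {s \<sqinter> t | s t. s \<in> S \<and> t \<in> T}" (is "down_directed L ?M")
  unfolding down_directed_def
proof (intro conjI ballI)
  have carrier: "S \<subseteq> carrier L" "T \<subseteq> carrier L"
    using S T by (simp_all add: down_directed_def)
  then show "?M \<subseteq> carrier L"
    by (auto intro!: meet_closed)
  show "?M \<noteq> {}"
    using S T unfolding down_directed_def by blast
  fix x y assume "x \<in> ?M" "y \<in> ?M"
  then obtain s1 t1 s2 t2 where st: "s1 \<in> S" "t1 \<in> T" "s2 \<in> S" "t2 \<in> T"
    and xy: "x = s1 \<sqinter> t1" "y = s2 \<sqinter> t2"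
    by blast
  obtain s where s: "s \<in> S" "s \<sqsubseteq> s1" "s \<sqsubseteq> s2"
    using S st unfolding down_directed_def by blast
  obtain t where t: "t \<in> T" "t \<sqsubseteq> t1" "t \<sqsubseteq> t2"
    using T st unfolding down_directed_def by blast
  have "s \<sqinter> t \<sqsubseteq> x" "s \<sqinter> t \<sqsubseteq> y"
    unfolding xy using s t st carrier by (auto intro!: meet_mono)
  then show "\<exists>u\<in>?M. u \<sqsubseteq> x \<and> u \<sqsubseteq> y"
    using s t by blast
qed

text \<open>A common lower bound in \<open>S\<close> of two witnesses lies below the meet, so
  \<open>S\<close> itself need not be closed under meets. Nonemptiness of \<open>S\<close> is what
  puts \<open>\<top>\<close> into the closure.\<close>

lemma is_filter_up_closure:
  assumes "down_directed L S"
  shows "is_filter L (up_closure L S)"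
  unfolding is_filter_def
proof (intro conjI ballI)
  have S: "S \<subseteq> carrier L"
    using assms by (simp add: down_directed_def)
  show "up_closure L S \<in> upsets L"
    using S unfolding up_closure_def upsets_def by (auto; meson le_trans subsetD)
  show "\<top> \<in> up_closure L S"
    using assms S unfolding up_closure_def down_directed_def by (auto intro: top_higher)
  show "a \<sqinter> b \<in> up_closure L S" if ab: "a \<in> up_closure L S" "b \<in> up_closure L S" for a b
  proof -
    obtain s t where st: "s \<in> S" "s \<sqsubseteq> a" "t \<in> S" "t \<sqsubseteq> b"
      and cab: "a \<in> carrier L" "b \<in> carrier L"
      using ab by (auto simp: up_closure_def)
    then obtain u where u: "u \<in> S" "u \<sqsubseteq> s" "u \<sqsubseteq> t"
      using assms unfolding down_directed_def by blast
    have "u \<sqsubseteq> a" "u \<sqsubseteq> b"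
      using u st cab S by (meson le_trans subsetD)+
    then have "u \<sqsubseteq> a \<sqinter> b"
      using u cab S by (blast intro: meet_le)
    then show ?thesis
      using u cab by (auto simp: up_closure_def)
  qed
qed

lemma up_closure_superset: "S \<subseteq> carrier L \<Longrightarrow> S \<subseteq> up_closure L S"
  unfolding up_closure_def using le_refl by blast

end

section \<open>Directed sets and prime filters under maps of lattices\<close>

lemma join_hom_mono:
  assumes "bounded_lattice A" "bounded_lattice B" "f \<in> carrier A \<rightarrow> carrier B"
    and join: "\<And>a b. a \<in> carrier A \<Longrightarrow> b \<in> carrier A \<Longrightarrow> f (a \<squnion>\<^bsub>A\<^esub> b) = f a \<squnion>\<^bsub>B\<^esub> f b"
    and "a \<in> carrier A" "b \<in> carrier A" "a \<sqsubseteq>\<^bsub>A\<^esub> b"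
  shows "f a \<sqsubseteq>\<^bsub>B\<^esub> f b"
proof -
  interpret A: bounded_lattice A by fact
  interpret B: bounded_lattice B by fact
  have "join_pres A B f"
    using join by (simp add: join_pres_def A.lattice_axioms B.lattice_axioms)
  then show ?thesis
    using assms join_pres_isotone use_iso2 by metis
qed

text \<open>The complement of a prime filter is an ideal, and a map preserving finite joins pulls
  ideals back to ideals. The identity and \<open>nabla\<close> are the two maps to which this is
  applied.\<close>

lemma up_directed_vimage_prime_compl:
  assumes "bounded_lattice A" "bounded_lattice B" "f \<in> carrier A \<rightarrow> carrier B"
    and "f \<bottom>\<^bsub>A\<^esub> = \<bottom>\<^bsub>B\<^esub>"
    and join: "\<And>a b. a \<in> carrier A \<Longrightarrow> b \<in> carrier A \<Longrightarrow> f (a \<squnion>\<^bsub>A\<^esub> b) = f a \<squnion>\<^bsub>B\<^esub> f b"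
    and P: "P \<in> prime_filters B"
  shows "up_directed A {a \<in> carrier A. f a \<notin> P}"
proof -
  interpret A: bounded_lattice A by fact
  interpret B: bounded_lattice B by fact
  have "\<bottom>\<^bsub>A\<^esub> \<in> {a \<in> carrier A. f a \<notin> P}"
    using assms prime_filter_bottom[OF P] by simp
  moreover have "a \<squnion>\<^bsub>A\<^esub> b \<in> {a \<in> carrier A. f a \<notin> P}"
    if "a \<in> carrier A" "b \<in> carrier A" "f a \<notin> P" "f b \<notin> P" for a b
    using that join B.prime_filter_join_iff[OF P] assms(3) by (simp add: Pi_iff)
  ultimately show ?thesis
    unfolding up_directed_def
    by (metis (no_types, lifting) A.join_left A.join_right empty_iff mem_Collect_eq subsetI)
qed

lemma (in bounded_lattice) up_directed_prime_compl:
  "P \<in> prime_filters L \<Longrightarrow> up_directed L (carrier L - P)"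
  using up_directed_vimage_prime_compl[OF bounded_lattice_axioms bounded_lattice_axioms, of "\<lambda>a. a" P]
  by (simp add: set_diff_eq)

lemma down_directed_image:
  assumes "down_directed A S" "f \<in> carrier A \<rightarrow> carrier B"
    and "\<And>a b. a \<in> carrier A \<Longrightarrow> b \<in> carrier A \<Longrightarrow> a \<sqsubseteq>\<^bsub>A\<^esub> b \<Longrightarrow> f a \<sqsubseteq>\<^bsub>B\<^esub> f b"
  shows "down_directed B (f ` S)"
  unfolding down_directed_def
proof (intro conjI ballI)
  fix x y assume "x \<in> f ` S" "y \<in> f ` S"
  then obtain s t where st: "s \<in> S" "t \<in> S" "x = f s" "y = f t"
    by blast
  then obtain u where "u \<in> S" "u \<sqsubseteq>\<^bsub>A\<^esub> s" "u \<sqsubseteq>\<^bsub>A\<^esub> t"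
    using assms(1) unfolding down_directed_def by blast
  then show "\<exists>v\<in>f ` S. v \<sqsubseteq>\<^bsub>B\<^esub> x \<and> v \<sqsubseteq>\<^bsub>B\<^esub> y"
    using st assms(1,3) unfolding down_directed_def by blast
qed (use assms in \<open>auto simp: down_directed_def Pi_iff\<close>)

lemma up_directed_image:
  assumes "up_directed A S" "f \<in> carrier A \<rightarrow> carrier B"
    and "\<And>a b. a \<in> carrier A \<Longrightarrow> b \<in> carrier A \<Longrightarrow> a \<sqsubseteq>\<^bsub>A\<^esub> b \<Longrightarrow> f a \<sqsubseteq>\<^bsub>B\<^esub> f b"
  shows "up_directed B (f ` S)"
  unfolding up_directed_def
proof (intro conjI ballI)
  fix x y assume "x \<in> f ` S" "y \<in> f ` S"
  then obtain s t where st: "s \<in> S" "t \<in> S" "x = f s" "y = f t"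
    by blast
  then obtain u where "u \<in> S" "s \<sqsubseteq>\<^bsub>A\<^esub> u" "t \<sqsubseteq>\<^bsub>A\<^esub> u"
    using assms(1) unfolding up_directed_def by blast
  then show "\<exists>v\<in>f ` S. x \<sqsubseteq>\<^bsub>B\<^esub> v \<and> y \<sqsubseteq>\<^bsub>B\<^esub> v"
    using st assms(1,3) unfolding up_directed_def by blast
qed (use assms in \<open>auto simp: up_directed_def Pi_iff\<close>)

text \<open>Stated for arbitrary maps of bounded lattices because it serves twice: for morphisms of
  algebras, and for \<open>nabla\<close> itself when (N) makes it a lattice endomorphism.\<close>

lemma prime_filter_vimage:
  assumes "bounded_lattice A" "bounded_lattice B" "f \<in> carrier A \<rightarrow> carrier B"
    and "f \<top>\<^bsub>A\<^esub> = \<top>\<^bsub>B\<^esub>" "f \<bottom>\<^bsub>A\<^esub> = \<bottom>\<^bsub>B\<^esub>"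
    and meet: "\<And>a b. a \<in> carrier A \<Longrightarrow> b \<in> carrier A \<Longrightarrow> f (a \<sqinter>\<^bsub>A\<^esub> b) = f a \<sqinter>\<^bsub>B\<^esub> f b"
    and join: "\<And>a b. a \<in> carrier A \<Longrightarrow> b \<in> carrier A \<Longrightarrow> f (a \<squnion>\<^bsub>A\<^esub> b) = f a \<squnion>\<^bsub>B\<^esub> f b"
    and P: "P \<in> prime_filters B"
  shows "f -` P \<inter> carrier A \<in> prime_filters A"
proof -
  interpret A: bounded_lattice A by fact
  interpret B: bounded_lattice B by fact
  have "f b \<in> P" if "a \<in> carrier A" "b \<in> carrier A" "a \<sqsubseteq>\<^bsub>A\<^esub> b" "f a \<in> P" for a b
    using prime_filter_up[OF P that(4) _ join_hom_mono[OF assms(1-3) join that(1-3)]]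
      that(2) assms(3) by (simp add: Pi_iff)
  then have "is_filter A (f -` P \<inter> carrier A)"
    using prime_filter_top[OF P] prime_filter_meet[OF P] by (intro is_filterI) (auto simp: assms(4) meet)
  then show ?thesis
    using prime_filter_bottom[OF P] B.prime_filter_join_iff[OF P] assms(3)
    by (auto simp: prime_filters_def assms(5) join Pi_iff)
qed

section \<open>Separation by prime filters in distributive lattices\<close>

locale distributive_lattice = bounded_lattice +
  assumes meet_join_distrib: "\<lbrakk>a \<in> carrier L; b \<in> carrier L; c \<in> carrier L\<rbrakk> \<Longrightarrow>
      a \<sqinter> (b \<squnion> c) = (a \<sqinter> b) \<squnion> (a \<sqinter> c)"
begin

text \<open>Zorn's lemma gives a filter \<open>M\<close> maximal among those that contain
  \<open>S\<close> and miss \<open>T\<close>. If neither \<open>a\<close> nor \<open>b\<close> is in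
  \<open>M\<close>, then enlarging \<open>M\<close> by either one hits \<open>T\<close>;
  up-directedness merges the two hits into one bound \<open>v\<close>, and distributivity then
  places an element of \<open>M\<close> below \<open>v\<close>, so that \<open>v\<close> lies in
  both \<open>M\<close> and \<open>T\<close>.\<close>

lemma prime_separation:
  assumes S: "down_directed L S" and T: "up_directed L T"
    and ST: "\<And>s t. s \<in> S \<Longrightarrow> t \<in> T \<Longrightarrow> \<not> s \<sqsubseteq> t"
  obtains P where "P \<in> prime_filters L" "S \<subseteq> P" "P \<inter> T = {}"
proof -
  have Sc: "S \<subseteq> carrier L" and Tc: "T \<subseteq> carrier L"
    using S T by (simp_all add: down_directed_def up_directed_def)
  define \<F> where "\<F> = {F. is_filter L F \<and> S \<subseteq> F \<and> F \<inter> T = {}}"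
  have "up_closure L S \<in> \<F>"
    using is_filter_up_closure[OF S] up_closure_superset[OF Sc] ST
    by (auto simp: \<F>_def up_closure_def)
  then have "\<F> \<noteq> {}"
    by blast
  moreover have "\<Union>\<C> \<in> \<F>" if "\<C> \<noteq> {}" and chain: "subset.chain \<F> \<C>" for \<C>
  proof -
    have \<C>: "\<And>F. F \<in> \<C> \<Longrightarrow> is_filter L F \<and> S \<subseteq> F \<and> F \<inter> T = {}"
      using chain unfolding subset_chain_def \<F>_def by blast
    have meets: "a \<sqinter> b \<in> \<Union>\<C>" if ab: "a \<in> F" "b \<in> G" "F \<in> \<C>" "G \<in> \<C>" for a b F G
    proof -
      have "F \<subseteq> G \<or> G \<subseteq> F"
        using chain ab unfolding subset_chain_def by blast
      then have "a \<sqinter> b \<in> F \<or> a \<sqinter> b \<in> G"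
        using ab \<C> by (meson is_filter_meet subsetD)
      then show ?thesis
        using ab by blast
    qed
    have top: "\<top> \<in> \<Union>\<C>"
      using \<open>\<C> \<noteq> {}\<close> \<C> is_filter_top by blast
    have "is_filter L (\<Union>\<C>)"
    proof (intro is_filterI)
      show "b \<in> \<Union>\<C>" if "a \<in> \<Union>\<C>" "b \<in> carrier L" "a \<sqsubseteq> b" for a b
      proof -
        obtain F where F: "F \<in> \<C>" "a \<in> F"
          using \<open>a \<in> \<Union>\<C>\<close> by blast
        then have "b \<in> F"
          using \<C> that is_filter_up by metis
        then show ?thesis
          using F by blast
      qed
      show "a \<in> carrier L" if "a \<in> \<Union>\<C>" for a
        using that \<C> by (auto intro: is_filter_carrier)
      show "a \<sqinter> b \<in> \<Union>\<C>" if "a \<in> \<Union>\<C>" "b \<in> \<Union>\<C>" for a b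
        using that meets by blast
    qed (rule top)
    then show ?thesis
      using \<C> \<open>\<C> \<noteq> {}\<close> unfolding \<F>_def by fastforce
  qed
  ultimately obtain M where "M \<in> \<F>" and max: "\<And>X. X \<in> \<F> \<Longrightarrow> M \<subseteq> X \<Longrightarrow> X = M"
    using subset_Zorn_nonempty[of \<F>] by metis
  then have M: "is_filter L M" "S \<subseteq> M" "M \<inter> T = {}"
    by (simp_all add: \<F>_def)
  note Mfilter = is_filterD[OF M(1)]
  \<comment> \<open>The filter generated by \<open>M\<close> and \<open>a\<close> is strictly larger
    than \<open>M\<close>, so by maximality it cannot miss \<open>T\<close>.\<close>
  have hit: "\<exists>m\<in>M. \<exists>t\<in>T. m \<sqinter> a \<sqsubseteq> t" if a: "a \<in> carrier L" "a \<notin> M" for a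
  proof -
    let ?S = "{m \<sqinter> t | m t. m \<in> M \<and> t \<in> {a}}"
    let ?G = "up_closure L ?S"
    have "is_filter L ?G"
      using a M by (intro is_filter_up_closure down_directed_meets down_directed_filter
          down_directed_singleton)
    moreover have "M \<subseteq> ?G"
    proof
      fix m assume "m \<in> M"
      then show "m \<in> ?G"
        using meet_left[of m a] a Mfilter(1) by (auto simp: up_closure_def)
    qed
    moreover have "a \<in> ?G"
      using meet_right[of \<top> a] a Mfilter(3) by (auto simp: up_closure_def)
    ultimately have "?G \<inter> T \<noteq> {}"
      using max[of ?G] M(2) a by (auto simp: \<F>_def)
    then show ?thesis
      by (auto simp: up_closure_def)
  qed
  have "a \<in> M \<or> b \<in> M" if ab: "a \<in> carrier L" "b \<in> carrier L" "a \<squnion> b \<in> M" for a b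
  proof (rule ccontr)
    assume "\<not> (a \<in> M \<or> b \<in> M)"
    then obtain m n t u where mn: "m \<in> M" "n \<in> M" "t \<in> T" "u \<in> T" "m \<sqinter> a \<sqsubseteq> t" "n \<sqinter> b \<sqsubseteq> u"
      using hit ab by meson
    then obtain v where v: "v \<in> T" "t \<sqsubseteq> v" "u \<sqsubseteq> v"
      using T unfolding up_directed_def by blast
    have c: "m \<in> carrier L" "n \<in> carrier L" "t \<in> carrier L" "u \<in> carrier L" "v \<in> carrier L"
      using mn v Tc Mfilter(1) by auto
    \<comment> \<open>One element of \<open>M\<close> that works for both inequalities, as is
      required before distributing over \<open>a \<squnion> b\<close>.\<close>
    let ?k = "m \<sqinter> n"
    have "?k \<sqinter> a \<sqsubseteq> m \<sqinter> a" "?k \<sqinter> b \<sqsubseteq> n \<sqinter> b"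
      using c ab by (simp_all add: meet_mono meet_left meet_right)
    then have "?k \<sqinter> a \<sqsubseteq> v" "?k \<sqinter> b \<sqsubseteq> v"
      using c ab mn v by (meson le_trans meet_closed)+
    then have "?k \<sqinter> (a \<squnion> b) \<sqsubseteq> v"
      using c ab by (simp add: meet_join_distrib join_le)
    moreover have "?k \<sqinter> (a \<squnion> b) \<in> M"
      using mn ab Mfilter(4) by simp
    ultimately have "v \<in> M"
      using Mfilter(2) c by simp
    then show False
      using v M by blast
  qed
  \<comment> \<open>Properness comes from \<open>T\<close> being nonempty: \<open>\<bottom>\<close>
    would drag every element of \<open>T\<close> into \<open>M\<close>.\<close>
  moreover have "\<bottom> \<notin> M"
  proof
    assume "\<bottom> \<in> M"
    moreover obtain t where "t \<in> T"
      using T by (auto simp: up_directed_def)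
    ultimately show False
      using Mfilter(2)[of \<bottom> t] M(3) Tc by auto
  qed
  ultimately have "M \<in> prime_filters L"
    using M by (simp add: prime_filters_def)
  then show thesis
    using that M by blast
qed

lemma prime_separation_elements:
  assumes "a \<in> carrier L" "b \<in> carrier L" "\<not> a \<sqsubseteq> b"
  obtains P where "P \<in> prime_filters L" "a \<in> P" "b \<notin> P"
proof -
  obtain P where "P \<in> prime_filters L" "{a} \<subseteq> P" "P \<inter> {b} = {}"
    using assms prime_separation[OF down_directed_singleton up_directed_singleton, of a b] by blast
  then show thesis
    using that by blast
qed

end

section \<open>Adjunction laws\<close>

context nabla_algebra
begin

lemma box_closed: "a \<in> carrier A \<Longrightarrow> box A a \<in> carrier A"
  by (simp add: box_def arrow_closed)

text \<open>The residuation law at \<open>\<top>\<close>, where the meet on the left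
  disappears.\<close>

lemma nabla_box_adjoint:
  assumes "c \<in> carrier A" "b \<in> carrier A"
  shows "nabla A c \<sqsubseteq> b \<longleftrightarrow> c \<sqsubseteq> box A b"
  using nabla_arrow[of \<top> b c] assms by (simp add: box_def meet_top_right nabla_closed)

lemma nabla_mono:
  assumes "a \<in> carrier A" "b \<in> carrier A" "a \<sqsubseteq> b"
  shows "nabla A a \<sqsubseteq> nabla A b"
  by (meson assms nabla_box_adjoint box_closed nabla_closed le_refl le_trans)

lemma box_mono:
  assumes "a \<in> carrier A" "b \<in> carrier A" "a \<sqsubseteq> b"
  shows "box A a \<sqsubseteq> box A b"
  by (meson assms nabla_box_adjoint box_closed nabla_closed le_refl le_trans)

lemma nabla_box_le: "a \<in> carrier A \<Longrightarrow> nabla A (box A a) \<sqsubseteq> a"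
  by (simp add: nabla_box_adjoint box_closed)

lemma le_box_nabla: "a \<in> carrier A \<Longrightarrow> a \<sqsubseteq> box A (nabla A a)"
  by (simp add: nabla_box_adjoint[symmetric] nabla_closed)

lemma nabla_bottom: "nabla A \<bottom> = \<bottom>"
  by (metis bottom_closed bottom_lower box_closed le_antisym nabla_box_adjoint nabla_closed)

text \<open>Left adjoints preserve joins: both \<open>a\<close> and \<open>b\<close> lie below the
  box of the join of their images, hence so does \<open>a \<squnion> b\<close>.\<close>

lemma nabla_join:
  assumes "a \<in> carrier A" "b \<in> carrier A"
  shows "nabla A (a \<squnion> b) = nabla A a \<squnion> nabla A b"
proof (rule le_antisym)
  let ?j = "nabla A a \<squnion> nabla A b"
  have "a \<squnion> b \<sqsubseteq> box A ?j"
    using assms by (intro join_le) (simp_all add: nabla_box_adjoint[symmetric] nabla_closed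
        box_closed join_left join_right)
  then show "nabla A (a \<squnion> b) \<sqsubseteq> ?j"
    using assms by (simp add: nabla_box_adjoint nabla_closed)
  show "?j \<sqsubseteq> nabla A (a \<squnion> b)"
    using assms by (intro join_le nabla_mono) (simp_all add: nabla_closed join_left join_right)
qed (use assms in \<open>simp_all add: nabla_closed\<close>)

text \<open>If \<open>a = nabla A c\<close>, then the unit gives
  \<open>c \<sqsubseteq> box A a\<close>, and applying \<open>nabla\<close> turns this into the
  missing inequality. Condition (Fa) thus makes \<open>box\<close> a section of
  \<open>nabla\<close>; the next lemma is the dual for (Fu).\<close>

lemma nabla_box_surj:
  assumes "nabla A ` carrier A = carrier A" "a \<in> carrier A"
  shows "nabla A (box A a) = a"
proof -
  obtain c where c: "c \<in> carrier A" "a = nabla A c"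
    using assms by blast
  then have "a \<sqsubseteq> nabla A (box A a)"
    using le_box_nabla nabla_mono box_closed assms(2) by metis
  then show ?thesis
    by (intro le_antisym) (simp_all add: assms(2) nabla_box_le box_closed nabla_closed)
qed

lemma box_nabla_surj:
  assumes "box A ` carrier A = carrier A" "a \<in> carrier A"
  shows "box A (nabla A a) = a"
proof -
  obtain c where c: "c \<in> carrier A" "a = box A c"
    using assms by blast
  then have "box A (nabla A a) \<sqsubseteq> a"
    using nabla_box_le box_mono nabla_closed assms(2) by metis
  then show ?thesis
    by (intro le_antisym) (simp_all add: assms(2) le_box_nabla box_closed nabla_closed)
qed

text \<open>From left to right, the defining condition is tested on
  \<open>arrow A \<top> (nabla A a)\<close>, which lies above \<open>a\<close> by the unit of the
  adjunction. From right to left, \<open>nabla A (arrow A a b) \<sqinter> a \<sqsubseteq> b\<close>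
  acts as modus ponens inside \<open>Q\<close>.\<close>

lemma prime_acc_iff:
  "(P, Q) \<in> prime_acc A \<longleftrightarrow>
     P \<in> prime_filters A \<and> Q \<in> prime_filters A \<and> (\<forall>a\<in>P. nabla A a \<in> Q)"
proof -
  have "(\<forall>a\<in>carrier A. \<forall>b\<in>carrier A. arrow A a b \<in> P \<and> a \<in> Q \<longrightarrow> b \<in> Q) \<longleftrightarrow>
      (\<forall>a\<in>P. nabla A a \<in> Q)" (is "?L \<longleftrightarrow> ?R")
    if P: "P \<in> prime_filters A" and Q: "Q \<in> prime_filters A"
  proof
    note P = prime_filtersD[OF P] and Q = prime_filtersD[OF Q]
    assume L: ?L
    show ?R
    proof
      fix a assume "a \<in> P"
      then have "a \<in> carrier A"
        by (rule P)
      then have "arrow A \<top> (nabla A a) \<in> P"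
        using P(3)[OF \<open>a \<in> P\<close> box_closed[OF nabla_closed] le_box_nabla] by (simp add: box_def)
      then show "nabla A a \<in> Q"
        using L[rule_format, of \<top> "nabla A a"] Q(4) \<open>a \<in> carrier A\<close> by (simp add: nabla_closed)
    qed
  next
    note P = prime_filtersD[OF P] and Q = prime_filtersD[OF Q]
    assume R: ?R
    show ?L
    proof (intro ballI impI)
      fix a b assume ab: "a \<in> carrier A" "b \<in> carrier A" and "arrow A a b \<in> P \<and> a \<in> Q"
      then have "nabla A (arrow A a b) \<sqinter> a \<in> Q"
        using R Q(5) by simp
      moreover have "nabla A (arrow A a b) \<sqinter> a \<sqsubseteq> b"
        using ab by (simp add: nabla_arrow arrow_closed)
      ultimately show "b \<in> Q"
        using Q(3) ab by simp
    qed
  qed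
  then show ?thesis
    unfolding prime_acc_def by auto
qed

lemma up_directed_nabla_compl:
  "P \<in> prime_filters A \<Longrightarrow> up_directed A {a \<in> carrier A. nabla A a \<notin> P}"
  by (rule up_directed_vimage_prime_compl[OF bounded_lattice_axioms bounded_lattice_axioms])
    (simp_all add: nabla_closed nabla_bottom nabla_join)

lemma down_directed_nabla: "is_filter A F \<Longrightarrow> down_directed A (nabla A ` F)"
  by (rule down_directed_image[OF down_directed_filter]) (simp_all add: nabla_closed nabla_mono)

end

sublocale distributive_nabla_algebra \<subseteq> distributive_lattice A
  by unfold_locales (rule distrib)

text \<open>Meeting with \<open>a\<close> has the right adjoint \<open>himp A a\<close>, hence
  preserves joins.\<close>

sublocale heyting_nabla_algebra \<subseteq> distributive_nabla_algebra A
proof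
  fix a b c assume c: "a \<in> carrier A" "b \<in> carrier A" "c \<in> carrier A"
  let ?r = "(a \<sqinter> b) \<squnion> (a \<sqinter> c)"
  have "b \<squnion> c \<sqsubseteq> himp A a ?r"
    using c by (intro join_le) (simp_all add: himp_residuation[symmetric] himp_closed
        meet_comm[of A _ a] join_left join_right)
  then have "a \<sqinter> (b \<squnion> c) \<sqsubseteq> ?r"
    using c by (simp add: himp_residuation[symmetric] meet_comm[of A a])
  moreover have "?r \<sqsubseteq> a \<sqinter> (b \<squnion> c)"
    using c by (intro join_le meet_mono) (simp_all add: join_left join_right)
  ultimately show "a \<sqinter> (b \<squnion> c) = ?r"
    using c by (intro le_antisym) simp_all
qed

section \<open>The frame of prime filters\<close>

lemma prime_frame_simps [simp]:
  "carrier (prime_frame A) = prime_filters A"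
  "eq (prime_frame A) = (=)"
  "le (prime_frame A) = (\<subseteq>)"
  "acc (prime_frame A) = prime_acc A"
  by (simp_all add: prime_frame_def)

lemma (in nabla_algebra) kripke_frame_prime_frame: "kripke_frame (prime_frame A)"
proof
  fix P P' Q Q'
  assume "P' \<in> carrier (prime_frame A)" "Q' \<in> carrier (prime_frame A)" "P' \<sqsubseteq>\<^bsub>prime_frame A\<^esub> P"
    "(P, Q) \<in> acc (prime_frame A)" "Q \<sqsubseteq>\<^bsub>prime_frame A\<^esub> Q'"
  then show "(P', Q') \<in> acc (prime_frame A)"
    by (auto simp: prime_acc_iff)
qed (auto simp: prime_acc_iff)

lemma kripke_frame_weak_partial_order: "kripke_frame K \<Longrightarrow> weak_partial_order K"
  by (simp add: kripke_frame_def partial_order_def)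

lemma (in distributive_nabla_algebra) frame_cond_prime_frame:
  assumes "alg_cond A c"
  shows "frame_cond (prime_frame A) c"
proof (cases c)
  case Cond_N
  \<comment> \<open>By \<open>prime_acc_iff\<close>, \<open>P\<close> is related to \<open>Q\<close>
    exactly when \<open>P\<close> is contained in the preimage of \<open>Q\<close> under
    \<open>nabla\<close>. Under (N) this preimage is itself a prime filter, so it is the required
    value of \<pi>.\<close>
  define \<pi> where "\<pi> = (\<lambda>Q. nabla A -` Q \<inter> carrier A)"
  have "\<pi> Q \<in> prime_filters A" if "Q \<in> prime_filters A" for Q
    unfolding \<pi>_def
    using assms that Cond_N
    by (intro prime_filter_vimage[OF bounded_lattice_axioms bounded_lattice_axioms])
      (simp_all add: nabla_closed nabla_bottom nabla_join)
  moreover have "isotone (prime_frame A) (prime_frame A) \<pi>"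
    unfolding \<pi>_def
    by (intro isotoneI kripke_frame_weak_partial_order kripke_frame_prime_frame) auto
  moreover have "(P, Q) \<in> prime_acc A \<longleftrightarrow> P \<subseteq> \<pi> Q"
    if "P \<in> prime_filters A" "Q \<in> prime_filters A" for P Q
    using that prime_filter_carrier[of P A] by (auto simp: prime_acc_iff \<pi>_def)
  ultimately show ?thesis
    unfolding Cond_N frame_cond.simps by (intro bexI[of _ \<pi>]) simp_all
next
  case Cond_R
  have "nabla A a \<in> P" if "P \<in> prime_filters A" "a \<in> P" for P a
  proof -
    have "a \<in> carrier A"
      using that by (rule prime_filter_carrier)
    then show ?thesis
      using assms Cond_R nabla_closed prime_filter_up[OF that] by simp
  qed
  then show ?thesis
    unfolding Cond_R frame_cond.simps by (simp add: prime_acc_iff)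
next
  case Cond_L
  have "a \<in> Q" if "(P, Q) \<in> prime_acc A" "a \<in> P" for P Q a
  proof -
    have "a \<in> carrier A" "nabla A a \<in> Q" "Q \<in> prime_filters A"
      using that prime_filter_carrier by (auto simp: prime_acc_iff)
    then show ?thesis
      using assms Cond_L prime_filter_up by fastforce
  qed
  then show ?thesis
    unfolding Cond_L frame_cond.simps by auto
next
  case Cond_Fa
  have surj: "nabla A ` carrier A = carrier A"
    using assms Cond_Fa by simp
  \<comment> \<open>Putting \<open>box A p\<close> into \<open>Q\<close> for each
    \<open>p \<in> P\<close> forces \<open>p = nabla A (box A p)\<close> into every successor of
    \<open>Q\<close>; avoiding all \<open>t\<close> with \<open>nabla A t \<notin> P\<close> makes
    \<open>P\<close> a successor. The two demands are compatible:
    \<open>box A p \<sqsubseteq> t\<close> would give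
    \<open>p \<sqsubseteq> nabla A t\<close>.\<close>
  have "\<exists>Q\<in>prime_filters A. (Q, P) \<in> prime_acc A \<and>
      (\<forall>Z\<in>prime_filters A. (Q, Z) \<in> prime_acc A \<longrightarrow> P \<subseteq> Z)"
    if P: "P \<in> prime_filters A" for P
  proof -
    have c: "a \<in> carrier A" if "a \<in> P" for a
      using P that by (rule prime_filter_carrier)
    have sep: "\<not> s \<sqsubseteq> t" if st: "s \<in> box A ` P" "t \<in> {a \<in> carrier A. nabla A a \<notin> P}" for s t
    proof
      assume "s \<sqsubseteq> t"
      obtain p where p: "p \<in> P" "s = box A p"
        using st by blast
      then have "p \<sqsubseteq> nabla A t"
        using nabla_mono[of s t] st c \<open>s \<sqsubseteq> t\<close> by (simp add: nabla_box_surj[OF surj] box_closed)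
      then show False
        using st p prime_filter_up[OF P] nabla_closed by auto
    qed
    have down: "down_directed A (box A ` P)"
      by (rule down_directed_image[OF down_directed_filter[OF prime_filter_is_filter[OF P]]])
        (simp_all add: box_closed box_mono)
    obtain Q where Q: "Q \<in> prime_filters A" "box A ` P \<subseteq> Q"
      "Q \<inter> {a \<in> carrier A. nabla A a \<notin> P} = {}"
      using prime_separation[OF down up_directed_nabla_compl[OF P] sep] by blast
    then have "(Q, P) \<in> prime_acc A"
      using P prime_filter_carrier[OF Q(1)] by (auto simp: prime_acc_iff)
    moreover have "P \<subseteq> Z" if "(Q, Z) \<in> prime_acc A" for Z
    proof
      fix p assume "p \<in> P"
      then have "nabla A (box A p) \<in> Z"
        using that Q(2) by (auto simp: prime_acc_iff)
      then show "p \<in> Z"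
        using c[OF \<open>p \<in> P\<close>] by (simp add: nabla_box_surj[OF surj])
    qed
    ultimately show ?thesis
      using Q(1) by blast
  qed
  then show ?thesis
    unfolding Cond_Fa frame_cond.simps by simp
next
  case Cond_Fu
  have surj: "box A ` carrier A = carrier A"
    using assms Cond_Fu by simp
  \<comment> \<open>Here \<open>Q\<close> should contain \<open>nabla A p\<close> for
    \<open>p \<in> P\<close> and no \<open>nabla A a\<close> for \<open>a\<close> outside
    \<open>P\<close>, so that a predecessor of \<open>Q\<close> can only have elements of
    \<open>P\<close>. If \<open>nabla A p \<sqsubseteq> nabla A a\<close>, then
    \<open>p \<sqsubseteq> box A (nabla A a) = a\<close>, which is impossible.\<close>
  have "\<exists>Q\<in>prime_filters A. (P, Q) \<in> prime_acc A \<and>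
      (\<forall>Z\<in>prime_filters A. (Z, Q) \<in> prime_acc A \<longrightarrow> Z \<subseteq> P)"
    if P: "P \<in> prime_filters A" for P
  proof -
    have c: "a \<in> carrier A" if "a \<in> P" for a
      using P that by (rule prime_filter_carrier)
    have sep: "\<not> s \<sqsubseteq> t" if st: "s \<in> nabla A ` P" "t \<in> nabla A ` (carrier A - P)" for s t
    proof
      assume "s \<sqsubseteq> t"
      obtain p a where pa: "p \<in> P" "s = nabla A p" "a \<in> carrier A" "a \<notin> P" "t = nabla A a"
        using st by blast
      then have "p \<sqsubseteq> box A (nabla A a)"
        using \<open>s \<sqsubseteq> t\<close> c by (simp add: nabla_box_adjoint[symmetric] nabla_closed)
      then have "p \<sqsubseteq> a"
        using pa by (simp add: box_nabla_surj[OF surj])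
      then show False
        using pa prime_filter_up[OF P] by blast
    qed
    have up: "up_directed A (nabla A ` (carrier A - P))"
      by (rule up_directed_image[OF up_directed_prime_compl[OF P]])
        (simp_all add: nabla_closed nabla_mono)
    obtain Q where Q: "Q \<in> prime_filters A" "nabla A ` P \<subseteq> Q"
      "Q \<inter> nabla A ` (carrier A - P) = {}"
      using prime_separation[OF down_directed_nabla[OF prime_filter_is_filter[OF P]] up sep] by blast
    then have "(P, Q) \<in> prime_acc A"
      using P by (auto simp: prime_acc_iff)
    moreover have "Z \<subseteq> P" if "(Z, Q) \<in> prime_acc A" for Z
    proof
      fix z assume "z \<in> Z"
      then have "z \<in> carrier A" "nabla A z \<in> Q"
        using that prime_filter_carrier by (auto simp: prime_acc_iff)
      then show "z \<in> P"
        using Q(3) by blast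
    qed
    ultimately show ?thesis
      using Q(1) by blast
  qed
  then show ?thesis
    unfolding Cond_Fu frame_cond.simps by simp
qed

section \<open>Morphisms\<close>

lemma nabla_homD:
  assumes "f \<in> nabla_hom A B"
  shows nabla_hom_funcset: "f \<in> carrier A \<rightarrow>\<^sub>E carrier B"
    and nabla_hom_closed: "a \<in> carrier A \<Longrightarrow> f a \<in> carrier B"
    and nabla_hom_meet: "a \<in> carrier A \<Longrightarrow> b \<in> carrier A \<Longrightarrow> f (a \<sqinter>\<^bsub>A\<^esub> b) = f a \<sqinter>\<^bsub>B\<^esub> f b"
    and nabla_hom_join: "a \<in> carrier A \<Longrightarrow> b \<in> carrier A \<Longrightarrow> f (a \<squnion>\<^bsub>A\<^esub> b) = f a \<squnion>\<^bsub>B\<^esub> f b"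
    and nabla_hom_top: "f \<top>\<^bsub>A\<^esub> = \<top>\<^bsub>B\<^esub>"
    and nabla_hom_bottom: "f \<bottom>\<^bsub>A\<^esub> = \<bottom>\<^bsub>B\<^esub>"
    and nabla_hom_nabla: "a \<in> carrier A \<Longrightarrow> f (nabla A a) = nabla B (f a)"
    and nabla_hom_arrow:
      "a \<in> carrier A \<Longrightarrow> b \<in> carrier A \<Longrightarrow> f (arrow A a b) = arrow B (f a) (f b)"
  using assms by (auto simp: nabla_hom_def meet_pres_def join_pres_def PiE_iff)

lemma nabla_homI:
  assumes "lattice A" "lattice B" "f \<in> carrier A \<rightarrow>\<^sub>E carrier B"
    and "\<And>a b. a \<in> carrier A \<Longrightarrow> b \<in> carrier A \<Longrightarrow> f (a \<sqinter>\<^bsub>A\<^esub> b) = f a \<sqinter>\<^bsub>B\<^esub> f b"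
    and "\<And>a b. a \<in> carrier A \<Longrightarrow> b \<in> carrier A \<Longrightarrow> f (a \<squnion>\<^bsub>A\<^esub> b) = f a \<squnion>\<^bsub>B\<^esub> f b"
    and "f \<top>\<^bsub>A\<^esub> = \<top>\<^bsub>B\<^esub>" "f \<bottom>\<^bsub>A\<^esub> = \<bottom>\<^bsub>B\<^esub>"
    and "\<And>a. a \<in> carrier A \<Longrightarrow> f (nabla A a) = nabla B (f a)"
    and "\<And>a b. a \<in> carrier A \<Longrightarrow> b \<in> carrier A \<Longrightarrow> f (arrow A a b) = arrow B (f a) (f b)"
  shows "f \<in> nabla_hom A B"
  using assms by (simp add: nabla_hom_def meet_pres_def join_pres_def)

lemma prime_map_apply: "Q \<in> prime_filters B \<Longrightarrow> prime_map A B f Q = f -` Q \<inter> carrier A"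
  by (simp add: prime_map_def)

text \<open>The common core of the two lifting conditions that demand equality: a prime filter lying
  exactly over \<open>Q'\<close> and containing a prescribed set \<open>G\<close>. For accessibility
  \<open>G\<close> is the image of a prime filter under \<open>nabla\<close>, for the order it is
  the prime filter itself. The hypothesis \<open>sep\<close> is the separation condition read
  contrapositively.\<close>

lemma prime_lift:
  assumes "bounded_lattice A" "distributive_lattice B" and f: "f \<in> nabla_hom A B"
    and Q': "Q' \<in> prime_filters A" and G: "down_directed B G"
    and sep: "\<And>g q a. g \<in> G \<Longrightarrow> q \<in> Q' \<Longrightarrow> a \<in> carrier A \<Longrightarrow> g \<sqinter>\<^bsub>B\<^esub> f q \<sqsubseteq>\<^bsub>B\<^esub> f a \<Longrightarrow> a \<in> Q'"
  obtains Q where "Q \<in> prime_filters B" "G \<subseteq> Q" "f -` Q \<inter> carrier A = Q'"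
proof -
  interpret A: bounded_lattice A by fact
  interpret B: distributive_lattice B by fact
  have f_fun: "f \<in> carrier A \<rightarrow> carrier B"
    using nabla_hom_funcset[OF f] by blast
  have mono: "f a \<sqsubseteq>\<^bsub>B\<^esub> f b" if "a \<in> carrier A" "b \<in> carrier A" "a \<sqsubseteq>\<^bsub>A\<^esub> b" for a b
    using join_hom_mono[OF assms(1) B.bounded_lattice_axioms f_fun nabla_hom_join[OF f] that] .
  let ?S = "{g \<sqinter>\<^bsub>B\<^esub> s | g s. g \<in> G \<and> s \<in> f ` Q'}"
  have "down_directed B (f ` Q')"
    using down_directed_image[OF A.down_directed_filter[OF prime_filter_is_filter[OF Q']] f_fun mono]
    by blast
  then have S: "down_directed B ?S"
    by (rule B.down_directed_meets[OF G])
  have T: "up_directed B (f ` (carrier A - Q'))"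
    using up_directed_image[OF A.up_directed_prime_compl[OF Q'] f_fun mono] by blast
  have ST: "\<not> s \<sqsubseteq>\<^bsub>B\<^esub> t" if "s \<in> ?S" "t \<in> f ` (carrier A - Q')" for s t
    using that sep by blast
  obtain Q where Q: "Q \<in> prime_filters B" "?S \<subseteq> Q" "Q \<inter> f ` (carrier A - Q') = {}"
    using B.prime_separation[OF S T ST] by blast
  have Gc: "G \<subseteq> carrier B" and Gne: "G \<noteq> {}"
    using G by (simp_all add: down_directed_def)
  have mem: "g \<in> Q \<and> f q \<in> Q" if "g \<in> G" "q \<in> Q'" for g q
  proof -
    have "g \<sqinter>\<^bsub>B\<^esub> f q \<in> Q"
      using Q(2) that by blast
    moreover have "g \<in> carrier B" "f q \<in> carrier B"
      using that Gc nabla_hom_closed[OF f] prime_filter_carrier[OF Q'] by auto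
    ultimately show ?thesis
      using B.prime_filter_meet_iff[OF Q(1)] by blast
  qed
  \<comment> \<open>Elements of \<open>?S\<close> are meets, so each factor needs a partner:
    \<open>\<top> \<in> Q'\<close> is the partner for elements of \<open>G\<close>, and any element
    of the nonempty \<open>G\<close> is one for the image of \<open>Q'\<close>.\<close>
  have "G \<subseteq> Q"
    using mem prime_filter_top[OF Q'] by blast
  moreover have "f -` Q \<inter> carrier A = Q'"
    using mem Gne Q(3) prime_filter_carrier[OF Q'] by blast
  ultimately show thesis
    using that Q(1) by blast
qed

lemma prime_map_closed:
  assumes "bounded_lattice A" "bounded_lattice B" "f \<in> nabla_hom A B" "P \<in> prime_filters B"
  shows "prime_map A B f P \<in> prime_filters A"
  unfolding prime_map_apply[OF assms(4)]
  by (rule prime_filter_vimage[OF assms(1,2)])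
    (use assms(4) nabla_homD[OF assms(3)] in \<open>simp_all add: Pi_iff\<close>)

text \<open>Each condition on a Kripke morphism reflects one operation: preservation of
  \<open>nabla\<close> gives both the preservation of accessibility and the lifting of predecessors,
  and preservation of \<open>arrow\<close> gives the lifting of successors.\<close>

lemma prime_map_kripke_hom:
  assumes "nabla_algebra A" "distributive_nabla_algebra B" and f: "f \<in> nabla_hom A B"
  shows "prime_map A B f \<in> kripke_hom (prime_frame B) (prime_frame A)"
proof -
  interpret A: nabla_algebra A by fact
  interpret B: distributive_nabla_algebra B by fact
  note hom = nabla_homD[OF f]
  have f_fun: "f \<in> carrier A \<rightarrow> carrier B"
    using hom(1) by blast
  have closed: "prime_map A B f P \<in> prime_filters A" if "P \<in> prime_filters B" for P
    using prime_map_closed[OF A.bounded_lattice_axioms B.bounded_lattice_axioms f that] .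
  have iso: "isotone (prime_frame B) (prime_frame A) (prime_map A B f)"
    by (intro isotoneI kripke_frame_weak_partial_order A.kripke_frame_prime_frame
        B.kripke_frame_prime_frame) (auto simp: prime_map_apply)
  have forth: "(prime_map A B f P, prime_map A B f Q) \<in> prime_acc A" if "(P, Q) \<in> prime_acc B" for P Q
    using that closed by (auto simp: A.prime_acc_iff B.prime_acc_iff prime_map_apply hom A.nabla_closed)
  have lift_acc: "\<exists>Q\<in>prime_filters B. (P, Q) \<in> prime_acc B \<and> prime_map A B f Q = Q'"
    if P: "P \<in> prime_filters B" and Q': "Q' \<in> prime_filters A"
      and acc: "(prime_map A B f P, Q') \<in> prime_acc A" for P Q'
  proof -
    \<comment> \<open>Residuation turns \<open>nabla B p \<sqinter> f q \<sqsubseteq> f a\<close>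
      into \<open>p \<sqsubseteq> f (arrow A q a)\<close>. Hence \<open>arrow A q a\<close> lies in
      the preimage of \<open>P\<close>, and the definition of \<open>prime_acc\<close> in terms of
      \<open>arrow\<close> yields \<open>a \<in> Q'\<close>.\<close>
    have sep: "a \<in> Q'" if gqa: "g \<in> nabla B ` P" "q \<in> Q'" "a \<in> carrier A" "g \<sqinter>\<^bsub>B\<^esub> f q \<sqsubseteq>\<^bsub>B\<^esub> f a" for g q a
    proof -
      obtain p where p: "p \<in> P" "g = nabla B p"
        using gqa(1) by blast
      have q: "q \<in> carrier A"
        using Q' gqa(2) by (rule prime_filter_carrier)
      have "p \<in> carrier B"
        using P p(1) by (rule prime_filter_carrier)
      then have "p \<sqsubseteq>\<^bsub>B\<^esub> f (arrow A q a)"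
        using gqa p q by (simp add: hom B.nabla_arrow)
      then have "f (arrow A q a) \<in> P"
        using prime_filter_up[OF P p(1)] hom(2) A.arrow_closed q gqa(3) by simp
      then have "arrow A q a \<in> prime_map A B f P"
        using P q gqa(3) by (simp add: prime_map_apply A.arrow_closed)
      then show "a \<in> Q'"
        using acc q gqa(2,3) unfolding prime_acc_def by blast
    qed
    obtain Q where Q: "Q \<in> prime_filters B" "nabla B ` P \<subseteq> Q" "f -` Q \<inter> carrier A = Q'"
      by (rule prime_lift[OF A.bounded_lattice_axioms B.distributive_lattice_axioms f Q'
            B.down_directed_nabla[OF prime_filter_is_filter[OF P]]]) (erule (3) sep, blast)
    then show ?thesis
      using P by (intro bexI[of _ Q]) (auto simp: B.prime_acc_iff prime_map_apply)
  qed
  have lift_acc_inv: "\<exists>Q\<in>prime_filters B. (Q, P) \<in> prime_acc B \<and> Q' \<subseteq> prime_map A B f Q"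
    if P: "P \<in> prime_filters B" and Q': "Q' \<in> prime_filters A"
      and acc: "(Q', prime_map A B f P) \<in> prime_acc A" for P Q'
  proof -
    have c: "q \<in> carrier A" if "q \<in> Q'" for q
      using Q' that by (rule prime_filter_carrier)
    have down: "down_directed B (f ` Q')"
      using join_hom_mono[OF A.bounded_lattice_axioms B.bounded_lattice_axioms f_fun hom(4)]
      by (intro down_directed_image[OF A.down_directed_filter[OF prime_filter_is_filter[OF Q']] f_fun]) blast
    \<comment> \<open>Since only an inclusion over \<open>Q'\<close> is asked for, \<open>T\<close>
      is left free to encode \<open>(Q, P) \<in> prime_acc B\<close>. If
      \<open>f q \<sqsubseteq> t\<close>, then \<open>f (nabla A q) \<sqsubseteq> nabla B t\<close>,
      and the left side is in \<open>P\<close> because \<open>Q'\<close> is related to the preimage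
      of \<open>P\<close>.\<close>
    have sep: "\<not> s \<sqsubseteq>\<^bsub>B\<^esub> t" if st: "s \<in> f ` Q'" "t \<in> {a \<in> carrier B. nabla B a \<notin> P}" for s t
    proof
      assume "s \<sqsubseteq>\<^bsub>B\<^esub> t"
      obtain q where q: "q \<in> Q'" "s = f q"
        using st by blast
      have "f (nabla A q) \<in> P"
        using acc q P by (auto simp: A.prime_acc_iff prime_map_apply)
      moreover have "f (nabla A q) \<sqsubseteq>\<^bsub>B\<^esub> nabla B t"
        using \<open>s \<sqsubseteq>\<^bsub>B\<^esub> t\<close> q st c by (simp add: hom B.nabla_mono)
      ultimately show False
        using prime_filter_up[OF P] st B.nabla_closed by auto
    qed
    obtain Q where Q: "Q \<in> prime_filters B" "f ` Q' \<subseteq> Q"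
      "Q \<inter> {a \<in> carrier B. nabla B a \<notin> P} = {}"
      using B.prime_separation[OF down B.up_directed_nabla_compl[OF P] sep] by blast
    then have "(Q, P) \<in> prime_acc B"
      using P prime_filter_carrier[OF Q(1)] by (auto simp: B.prime_acc_iff)
    then show ?thesis
      using Q c by (intro bexI[of _ Q]) (auto simp: prime_map_apply)
  qed
  have "prime_map A B f \<in> prime_filters B \<rightarrow>\<^sub>E prime_filters A"
    using closed by (auto simp: prime_map_def)
  then show ?thesis
    using iso forth lift_acc lift_acc_inv unfolding kripke_hom_def by simp blast
qed

text \<open>Lifting along inclusion repeats the lifting of successors, with \<open>P\<close> itself
  in place of its image under \<open>nabla\<close> and \<open>himp\<close> in place of
  \<open>arrow\<close>.\<close>

lemma prime_map_heyting_kripke_hom: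
  assumes "heyting_nabla_algebra A" "heyting_nabla_algebra B" and f: "f \<in> heyting_nabla_hom A B"
  shows "prime_map A B f \<in> heyting_kripke_hom (prime_frame B) (prime_frame A)"
proof -
  interpret A: heyting_nabla_algebra A by fact
  interpret B: heyting_nabla_algebra B by fact
  have f': "f \<in> nabla_hom A B"
    and himp: "\<And>a b. a \<in> carrier A \<Longrightarrow> b \<in> carrier A \<Longrightarrow> f (himp A a b) = himp B (f a) (f b)"
    using f by (simp_all add: heyting_nabla_hom_def)
  note hom = nabla_homD[OF f']
  have "\<exists>Q\<in>prime_filters B. P \<subseteq> Q \<and> prime_map A B f Q = Q'"
    if P: "P \<in> prime_filters B" and Q': "Q' \<in> prime_filters A" and sub: "prime_map A B f P \<subseteq> Q'" for P Q'
  proof -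
    have sep: "a \<in> Q'" if "p \<in> P" "q \<in> Q'" "a \<in> carrier A" "p \<sqinter>\<^bsub>B\<^esub> f q \<sqsubseteq>\<^bsub>B\<^esub> f a" for p q a
    proof -
      have q: "q \<in> carrier A"
        using Q' that(2) by (rule prime_filter_carrier)
      have "p \<in> carrier B"
        using P that(1) by (rule prime_filter_carrier)
      then have "p \<sqsubseteq>\<^bsub>B\<^esub> f (himp A q a)"
        using that q by (simp add: hom himp B.himp_residuation)
      then have "f (himp A q a) \<in> P"
        using prime_filter_up[OF P that(1)] hom(2) A.himp_closed q that(3) by simp
      then have "himp A q a \<in> Q'"
        using sub P q that(3) by (auto simp: prime_map_apply A.himp_closed)
      then have "himp A q a \<sqinter>\<^bsub>A\<^esub> q \<in> Q'"
        using that(2) by (rule prime_filter_meet[OF Q'])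
      moreover have "himp A q a \<sqinter>\<^bsub>A\<^esub> q \<sqsubseteq>\<^bsub>A\<^esub> a"
        using q that(3) by (simp add: A.himp_residuation A.himp_closed)
      ultimately show "a \<in> Q'"
        using that(3) prime_filter_up[OF Q'] by blast
    qed
    obtain Q where Q: "Q \<in> prime_filters B" "P \<subseteq> Q" "f -` Q \<inter> carrier A = Q'"
      by (rule prime_lift[OF A.bounded_lattice_axioms B.distributive_lattice_axioms f' Q'
            B.down_directed_filter[OF prime_filter_is_filter[OF P]]]) (erule (3) sep, blast)
    then show ?thesis
      by (intro bexI[of _ Q]) (auto simp: prime_map_apply)
  qed
  then show ?thesis
    using prime_map_kripke_hom[OF A.nabla_algebra_axioms B.distributive_nabla_algebra_axioms f']
    by (simp add: heyting_kripke_hom_def)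
qed

section \<open>Algebras of upsets\<close>

text \<open>Fixes only the carrier, equality and order of \<open>L\<close>, so that the two record
  types behind \<open>upset_alg\<close> and \<open>upset_alg_H\<close> share one
  development.\<close>

locale upset_lattice =
  fixes K :: "('w, 'k) gorder_scheme" and L :: "('w set, 'l) gorder_scheme"
  assumes carrier_eq: "carrier L = upsets K"
    and eq_eq: "eq L = (=)"
    and le_eq: "le L = (\<subseteq>)"
begin

lemma Int_closed: "U \<in> upsets K \<Longrightarrow> V \<in> upsets K \<Longrightarrow> U \<inter> V \<in> upsets K"
  unfolding upsets_def by blast

lemma Un_closed: "U \<in> upsets K \<Longrightarrow> V \<in> upsets K \<Longrightarrow> U \<union> V \<in> upsets K"
  unfolding upsets_def by blast

lemma carrier_closed: "carrier K \<in> upsets K"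
  unfolding upsets_def by blast

lemma empty_closed: "{} \<in> upsets K"
  unfolding upsets_def by blast

lemma upset_bounded_lattice: "bounded_lattice L"
proof -
  interpret partial_order L
    by unfold_locales (auto simp: eq_eq le_eq)
  show ?thesis
  proof
    fix U V assume UV: "U \<in> carrier L" "V \<in> carrier L"
    show "\<exists>s. least L s (Upper L {U, V})"
      using UV Un_closed[of U V]
      by (intro exI[of _ "U \<union> V"]) (simp add: least_def Upper_def le_eq carrier_eq)
    show "\<exists>s. greatest L s (Lower L {U, V})"
      using UV Int_closed[of U V]
      by (intro exI[of _ "U \<inter> V"]) (simp add: greatest_def Lower_def le_eq carrier_eq)
  next
    show "\<exists>s. least L s (carrier L)"
      using empty_closed by (intro exI[of _ "{}"]) (simp add: least_def le_eq carrier_eq)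
    show "\<exists>s. greatest L s (carrier L)"
      using carrier_closed
      by (intro exI[of _ "carrier K"]) (auto simp: greatest_def le_eq carrier_eq upsets_def)
  qed
qed

sublocale bounded_lattice L
  by (rule upset_bounded_lattice)

text \<open>The operation \<sqinter> is a chosen greatest lower bound, determined by the order
  alone; its universal property identifies it with intersection. The same holds for the join, top
  and bottom.\<close>

lemma meet_eq:
  assumes "U \<in> upsets K" "V \<in> upsets K"
  shows "U \<sqinter>\<^bsub>L\<^esub> V = U \<inter> V"
  using meet_left[of U V] meet_right[of U V] meet_le[of "U \<inter> V" U V] assms Int_closed[OF assms]
  by (simp add: carrier_eq le_eq) blast

lemma join_eq:
  assumes "U \<in> upsets K" "V \<in> upsets K"
  shows "U \<squnion>\<^bsub>L\<^esub> V = U \<union> V"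
  using join_left[of U V] join_right[of U V] join_le[of U "U \<union> V" V] assms Un_closed[OF assms]
  by (simp add: carrier_eq le_eq) blast

lemma top_eq_carrier: "\<top>\<^bsub>L\<^esub> = carrier K"
  using top_eq[of "carrier K"] carrier_closed by (auto simp: carrier_eq le_eq upsets_def)

lemma bottom_eq_empty: "\<bottom>\<^bsub>L\<^esub> = {}"
  using bottom_eq[of "{}"] empty_closed by (auto simp: carrier_eq le_eq)

end

locale upset_nabla_algebra = kripke_frame K + upset_lattice K L
  for K :: "('w, 'k) kripke_frame_scheme" (structure)
    and L :: "('w set, 'l) nabla_algebra_scheme" +
  assumes nabla_eq: "nabla L = upset_nabla K"
    and arrow_eq: "arrow L = upset_arrow K"
begin

lemma upset_nabla_closed:
  assumes "U \<in> upsets K"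
  shows "upset_nabla K U \<in> upsets K"
proof -
  have "\<exists>z\<in>U. (z, y) \<in> acc K" if "z \<in> U" "(z, x) \<in> acc K" "x \<sqsubseteq> y" "y \<in> carrier K" for x y z
    using that assms acc_compat[of z y z x] by (auto simp: upsets_def)
  then show ?thesis
    unfolding upset_nabla_def upsets_def by blast
qed

lemma upset_arrow_closed:
  assumes "U \<in> upsets K" "V \<in> upsets K"
  shows "upset_arrow K U V \<in> upsets K"
proof -
  have "(x, z) \<in> acc K" if "(y, z) \<in> acc K" "x \<sqsubseteq> y" "x \<in> carrier K" for x y z
    using that acc_subset acc_compat[of x z y z] by blast
  then show ?thesis
    unfolding upset_arrow_def upsets_def by blast
qed

lemma distributive_nabla_algebra: "distributive_nabla_algebra L"
proof
  show "nabla L U \<in> carrier L" if "U \<in> carrier L" for U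
    using that by (simp add: carrier_eq nabla_eq upset_nabla_closed)
  show "arrow L U V \<in> carrier L" if "U \<in> carrier L" "V \<in> carrier L" for U V
    using that by (simp add: carrier_eq arrow_eq upset_arrow_closed)
  \<comment> \<open>Unfolded, both sides say the same: whenever \<open>y \<in> W\<close> is related
    to \<open>x \<in> U\<close>, then \<open>x \<in> V\<close>.\<close>
  show "nabla L W \<sqinter>\<^bsub>L\<^esub> U \<sqsubseteq>\<^bsub>L\<^esub> V \<longleftrightarrow> W \<sqsubseteq>\<^bsub>L\<^esub> arrow L U V"
    if UVW: "U \<in> carrier L" "V \<in> carrier L" "W \<in> carrier L" for U V W
  proof -
    have "nabla L W \<sqinter>\<^bsub>L\<^esub> U = upset_nabla K W \<inter> U"
      using UVW by (simp add: carrier_eq nabla_eq upset_nabla_closed meet_eq)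
    moreover have "U \<subseteq> carrier K" "W \<subseteq> carrier K"
      using UVW by (simp_all add: carrier_eq upsets_def)
    ultimately show ?thesis
      by (simp add: le_eq arrow_eq) (auto simp: upset_nabla_def upset_arrow_def)
  qed
  show "U \<sqinter>\<^bsub>L\<^esub> (V \<squnion>\<^bsub>L\<^esub> W) = (U \<sqinter>\<^bsub>L\<^esub> V) \<squnion>\<^bsub>L\<^esub> (U \<sqinter>\<^bsub>L\<^esub> W)"
    if "U \<in> carrier L" "V \<in> carrier L" "W \<in> carrier L" for U V W
    using that by (simp add: carrier_eq meet_eq join_eq Int_closed Un_closed Int_Un_distrib)
qed

end

lemma upset_nabla_algebra_upset_alg:
  "kripke_frame K \<Longrightarrow> upset_nabla_algebra K (upset_alg K)"
  by (simp add: upset_nabla_algebra_def upset_nabla_algebra_axioms_def upset_lattice_def upset_alg_def)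

lemma upset_nabla_algebra_upset_alg_H:
  "kripke_frame K \<Longrightarrow> upset_nabla_algebra K (upset_alg_H K)"
  by (simp add: upset_nabla_algebra_def upset_nabla_algebra_axioms_def upset_lattice_def upset_alg_H_def)

lemma heyting_nabla_algebra_upset_alg_H:
  assumes "kripke_frame K"
  shows "heyting_nabla_algebra (upset_alg_H K)"
proof -
  interpret K: kripke_frame K by fact
  interpret upset_nabla_algebra K "upset_alg_H K"
    by (rule upset_nabla_algebra_upset_alg_H[OF assms])
  interpret N: distributive_nabla_algebra "upset_alg_H K"
    by (rule distributive_nabla_algebra)
  have himp: "himp (upset_alg_H K) = upset_himp K"
    by (simp add: upset_alg_H_def)
  show ?thesis
  proof
    fix U V assume UV: "U \<in> carrier (upset_alg_H K)" "V \<in> carrier (upset_alg_H K)"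
    then have sub: "U \<subseteq> carrier K" "V \<subseteq> carrier K"
      by (simp_all add: carrier_eq upsets_def)
    have "x \<in> upset_himp K U V"
      if yx: "y \<in> upset_himp K U V" "x \<in> carrier K" "y \<sqsubseteq>\<^bsub>K\<^esub> x" for x y
    proof -
      have "z \<in> V" if "z \<in> U" "x \<sqsubseteq>\<^bsub>K\<^esub> z" for z
        using yx that sub K.le_trans[of y x z] by (auto simp: upset_himp_def)
      then show ?thesis
        using yx(2) by (simp add: upset_himp_def)
    qed
    then show "himp (upset_alg_H K) U V \<in> carrier (upset_alg_H K)"
      unfolding himp carrier_eq upsets_def by (auto simp: upset_himp_def)
    fix W assume W: "W \<in> carrier (upset_alg_H K)"
    then have up: "y \<in> W" if "x \<in> W" "x \<sqsubseteq>\<^bsub>K\<^esub> y" "y \<in> carrier K" for x y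
      using that by (auto simp: carrier_eq upsets_def)
    have "W \<subseteq> carrier K"
      using W by (simp add: carrier_eq upsets_def)
    \<comment> \<open>Left to right uses that \<open>W\<close> is an upset; right to left is
      reflexivity of the order.\<close>
    then have "W \<inter> U \<subseteq> V \<longleftrightarrow> W \<subseteq> upset_himp K U V"
      using sub up unfolding upset_himp_def by blast
    then show "W \<sqinter>\<^bsub>upset_alg_H K\<^esub> U \<sqsubseteq>\<^bsub>upset_alg_H K\<^esub> V \<longleftrightarrow>
        W \<sqsubseteq>\<^bsub>upset_alg_H K\<^esub> himp (upset_alg_H K) U V"
      using UV W by (simp add: carrier_eq meet_eq le_eq himp)
  qed
qed

section \<open>Preimages of upsets along Kripke morphisms\<close>

lemma kripke_homD:
  assumes "f \<in> kripke_hom K K'"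
  shows kripke_hom_funcset: "f \<in> carrier K \<rightarrow>\<^sub>E carrier K'"
    and kripke_hom_closed: "k \<in> carrier K \<Longrightarrow> f k \<in> carrier K'"
    and kripke_hom_isotone: "isotone K K' f"
    and kripke_hom_acc: "(k, l) \<in> acc K \<Longrightarrow> (f k, f l) \<in> acc K'"
    and kripke_hom_lift: "k \<in> carrier K \<Longrightarrow> l' \<in> carrier K' \<Longrightarrow> (f k, l') \<in> acc K' \<Longrightarrow>
      \<exists>l\<in>carrier K. (k, l) \<in> acc K \<and> f l = l'"
    and kripke_hom_lift_converse: "k \<in> carrier K \<Longrightarrow> l' \<in> carrier K' \<Longrightarrow> (l', f k) \<in> acc K' \<Longrightarrow>
      \<exists>l\<in>carrier K. (l, k) \<in> acc K \<and> l' \<sqsubseteq>\<^bsub>K'\<^esub> f l"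
  using assms by (auto simp: kripke_hom_def PiE_iff)

text \<open>Isotonicity makes preimages of upsets upsets. Preservation of accessibility gives one
  inclusion each for \<open>nabla\<close> and \<open>arrow\<close>; the other inclusion is lifting
  of predecessors for \<open>nabla\<close> and lifting of successors for
  \<open>arrow\<close>.\<close>

lemma upset_map_nabla_hom:
  assumes "upset_nabla_algebra K L" "upset_nabla_algebra K' L'" and f: "f \<in> kripke_hom K K'"
  shows "upset_map K K' f \<in> nabla_hom L' L"
proof -
  interpret L: upset_nabla_algebra K L by fact
  interpret L': upset_nabla_algebra K' L' by fact
  note hom = kripke_homD[OF f]
  have app: "upset_map K K' f U = f -` U \<inter> carrier K" if "U \<in> upsets K'" for U
    using that by (simp add: upset_map_def)
  have closed: "f -` U \<inter> carrier K \<in> upsets K" if "U \<in> upsets K'" for U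
    using that use_iso2[OF hom(3)] hom(2) unfolding upsets_def by blast
  have nabla: "f -` upset_nabla K' U \<inter> carrier K = upset_nabla K (f -` U \<inter> carrier K)"
    if U: "U \<in> upsets K'" for U
  proof (intro equalityI subsetI)
    fix x assume "x \<in> f -` upset_nabla K' U \<inter> carrier K"
    then obtain y where y: "x \<in> carrier K" "y \<in> U" "(y, f x) \<in> acc K'"
      by (auto simp: upset_nabla_def)
    then obtain l where l: "l \<in> carrier K" "(l, x) \<in> acc K" "y \<sqsubseteq>\<^bsub>K'\<^esub> f l"
      using hom(6)[of x y] L'.acc_subset by blast
    \<comment> \<open>The lifted point is only known to map above \<open>y\<close>; this suffices
      because \<open>U\<close> is an upset.\<close>
    then have "f l \<in> U"
      using U y hom(2)[of l] unfolding upsets_def by blast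
    then show "x \<in> upset_nabla K (f -` U \<inter> carrier K)"
      using l y by (auto simp: upset_nabla_def)
  next
    fix x assume "x \<in> upset_nabla K (f -` U \<inter> carrier K)"
    then show "x \<in> f -` upset_nabla K' U \<inter> carrier K"
      using hom(2,4) by (auto simp: upset_nabla_def)
  qed
  have arrow: "f -` upset_arrow K' U V \<inter> carrier K =
      upset_arrow K (f -` U \<inter> carrier K) (f -` V \<inter> carrier K)"
    if UV: "U \<in> upsets K'" "V \<in> upsets K'" for U V
  proof (intro equalityI subsetI)
    fix x assume "x \<in> f -` upset_arrow K' U V \<inter> carrier K"
    then show "x \<in> upset_arrow K (f -` U \<inter> carrier K) (f -` V \<inter> carrier K)"
      using hom(4) by (auto simp: upset_arrow_def)
  next
    fix x assume x: "x \<in> upset_arrow K (f -` U \<inter> carrier K) (f -` V \<inter> carrier K)"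
    then have xK: "x \<in> carrier K"
      by (simp add: upset_arrow_def)
    have "y \<in> V" if "y \<in> U" "(f x, y) \<in> acc K'" for y
      using hom(5)[OF xK _ that(2)] that x UV L'.acc_subset by (auto simp: upset_arrow_def)
    then show "x \<in> f -` upset_arrow K' U V \<inter> carrier K"
      using xK hom(2) by (simp add: upset_arrow_def)
  qed
  show ?thesis
  proof (rule nabla_homI)
    show "lattice L'" "lattice L"
      by (rule L'.lattice_axioms L.lattice_axioms)+
    show "upset_map K K' f \<in> carrier L' \<rightarrow>\<^sub>E carrier L"
      using closed by (simp add: upset_map_def L.carrier_eq L'.carrier_eq)
    show "upset_map K K' f \<top>\<^bsub>L'\<^esub> = \<top>\<^bsub>L\<^esub>"
      using hom(2) by (auto simp: L.top_eq_carrier L'.top_eq_carrier app L'.carrier_closed)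
    show "upset_map K K' f \<bottom>\<^bsub>L'\<^esub> = \<bottom>\<^bsub>L\<^esub>"
      by (simp add: L.bottom_eq_empty L'.bottom_eq_empty app L'.empty_closed)
  next
    fix U assume "U \<in> carrier L'"
    then show "upset_map K K' f (nabla L' U) = nabla L (upset_map K K' f U)"
      by (simp add: L'.carrier_eq L.nabla_eq L'.nabla_eq app L'.upset_nabla_closed nabla)
  next
    fix U V assume UV: "U \<in> carrier L'" "V \<in> carrier L'"
    then show "upset_map K K' f (U \<sqinter>\<^bsub>L'\<^esub> V) = upset_map K K' f U \<sqinter>\<^bsub>L\<^esub> upset_map K K' f V"
      by (auto simp: L'.carrier_eq L.meet_eq L'.meet_eq app L'.Int_closed closed)
    show "upset_map K K' f (U \<squnion>\<^bsub>L'\<^esub> V) = upset_map K K' f U \<squnion>\<^bsub>L\<^esub> upset_map K K' f V"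
      using UV by (auto simp: L'.carrier_eq L.join_eq L'.join_eq app L'.Un_closed closed)
    show "upset_map K K' f (arrow L' U V) = arrow L (upset_map K K' f U) (upset_map K K' f V)"
      using UV by (simp add: L'.carrier_eq L.arrow_eq L'.arrow_eq app L'.upset_arrow_closed arrow)
  qed
qed

section \<open>The embedding\<close>

lemma prime_embed_apply:
  "a \<in> carrier A \<Longrightarrow> prime_embed A a = {P \<in> prime_filters A. a \<in> P}"
  by (simp add: prime_embed_def)

lemma prime_embed_closed: "a \<in> carrier A \<Longrightarrow> prime_embed A a \<in> upsets (prime_frame A)"
  by (auto simp: prime_embed_apply upsets_def)

context distributive_nabla_algebra
begin

lemma prime_embed_inj: "inj_on (prime_embed A) (carrier A)"
proof (rule inj_onI, rule ccontr)
  fix a b assume ab: "a \<in> carrier A" "b \<in> carrier A" "prime_embed A a = prime_embed A b" "a \<noteq> b"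
  then have "\<not> a \<sqsubseteq> b \<or> \<not> b \<sqsubseteq> a"
    using le_antisym by blast
  then obtain P where "P \<in> prime_filters A" "a \<in> P \<longleftrightarrow> b \<notin> P"
    using prime_separation_elements[OF ab(1,2)] prime_separation_elements[OF ab(2,1)] by metis
  then show False
    using ab by (auto simp: prime_embed_apply)
qed

text \<open>The substantial inclusion needs a predecessor of \<open>Q\<close> containing
  \<open>a\<close>. It exists because \<open>a \<sqsubseteq> t\<close> and
  \<open>nabla A a \<in> Q\<close> force \<open>nabla A t \<in> Q\<close>.\<close>

lemma prime_embed_nabla:
  assumes a: "a \<in> carrier A"
  shows "prime_embed A (nabla A a) = upset_nabla (prime_frame A) (prime_embed A a)"
proof (intro equalityI subsetI)
  fix Q assume "Q \<in> prime_embed A (nabla A a)"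
  then have Q: "Q \<in> prime_filters A" "nabla A a \<in> Q"
    using a by (simp_all add: prime_embed_apply nabla_closed)
  have sep: "\<not> s \<sqsubseteq> t" if st: "s \<in> {a}" "t \<in> {x \<in> carrier A. nabla A x \<notin> Q}" for s t
    using st a Q nabla_mono[of s t] prime_filter_up[OF Q, of "nabla A t"] nabla_closed by auto
  obtain P where P: "P \<in> prime_filters A" "{a} \<subseteq> P" "P \<inter> {x \<in> carrier A. nabla A x \<notin> Q} = {}"
    using prime_separation[OF down_directed_singleton[OF a] up_directed_nabla_compl[OF Q(1)] sep]
    by blast
  then have "(P, Q) \<in> prime_acc A"
    using Q prime_filter_carrier[OF P(1)] by (auto simp: prime_acc_iff)
  then show "Q \<in> upset_nabla (prime_frame A) (prime_embed A a)"
    using P Q a by (auto simp: upset_nabla_def prime_embed_apply)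
next
  fix Q assume "Q \<in> upset_nabla (prime_frame A) (prime_embed A a)"
  then show "Q \<in> prime_embed A (nabla A a)"
    using a by (auto simp: upset_nabla_def prime_embed_apply nabla_closed prime_acc_iff)
qed

text \<open>If \<open>arrow A a b\<close> is missing from \<open>P\<close>, a successor of
  \<open>P\<close> containing \<open>a\<close> but not \<open>b\<close> must be found. The only
  obstruction would be \<open>nabla A p \<sqinter> a \<sqsubseteq> b\<close> for some
  \<open>p \<in> P\<close>, which residuation turns into
  \<open>p \<sqsubseteq> arrow A a b\<close>.\<close>

lemma prime_embed_arrow:
  assumes ab: "a \<in> carrier A" "b \<in> carrier A"
  shows "prime_embed A (arrow A a b) =
    upset_arrow (prime_frame A) (prime_embed A a) (prime_embed A b)"
proof (intro equalityI subsetI)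
  fix P assume "P \<in> prime_embed A (arrow A a b)"
  then show "P \<in> upset_arrow (prime_frame A) (prime_embed A a) (prime_embed A b)"
    using ab by (auto simp: upset_arrow_def prime_embed_apply arrow_closed prime_acc_def)
next
  fix P assume "P \<in> upset_arrow (prime_frame A) (prime_embed A a) (prime_embed A b)"
  then have P: "P \<in> prime_filters A"
    and imp: "\<And>Q. Q \<in> prime_filters A \<Longrightarrow> a \<in> Q \<Longrightarrow> (P, Q) \<in> prime_acc A \<Longrightarrow> b \<in> Q"
    using ab by (auto simp: upset_arrow_def prime_embed_apply)
  let ?S = "{s \<sqinter> t | s t. s \<in> nabla A ` P \<and> t \<in> {a}}"
  have "arrow A a b \<in> P"
  proof (rule ccontr)
    assume notin: "arrow A a b \<notin> P"
    have down: "down_directed A ?S"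
      using down_directed_meets[OF down_directed_nabla[OF prime_filter_is_filter[OF P]]
          down_directed_singleton[OF ab(1)]] .
    have sep: "\<not> s \<sqsubseteq> t" if st: "s \<in> ?S" "t \<in> {b}" for s t
    proof
      assume "s \<sqsubseteq> t"
      then obtain p where p: "p \<in> P" "nabla A p \<sqinter> a \<sqsubseteq> b"
        using st by blast
      then have "p \<sqsubseteq> arrow A a b"
        using ab prime_filter_carrier[OF P] by (simp add: nabla_arrow)
      then show False
        using prime_filter_up[OF P p(1)] notin ab arrow_closed by blast
    qed
    obtain Q where Q: "Q \<in> prime_filters A" "?S \<subseteq> Q" "Q \<inter> {b} = {}"
      using prime_separation[OF down up_directed_singleton[OF ab(2)] sep] by blast
    have mem: "nabla A p \<in> Q \<and> a \<in> Q" if "p \<in> P" for p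
    proof -
      have "nabla A p \<sqinter> a \<in> Q"
        using Q(2) that by blast
      then show ?thesis
        using prime_filter_meet_iff[OF Q(1)] ab nabla_closed prime_filter_carrier[OF P that] by simp
    qed
    then have "(P, Q) \<in> prime_acc A"
      using P Q by (simp add: prime_acc_iff)
    \<comment> \<open>That \<open>a \<in> Q\<close> is read off from \<open>mem\<close> at
      \<open>p = \<top>\<close>.\<close>
    then have "b \<in> Q"
      using imp Q(1) mem prime_filter_top[OF P] by blast
    then show False
      using Q(3) by blast
  qed
  then show "P \<in> prime_embed A (arrow A a b)"
    using P ab by (simp add: prime_embed_apply arrow_closed)
qed

lemma prime_embed_nabla_hom:
  assumes "upset_nabla_algebra (prime_frame A) L"
  shows "prime_embed A \<in> nabla_hom A L"
proof -
  interpret L: upset_nabla_algebra "prime_frame A" L by fact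
  show ?thesis
  proof (rule nabla_homI)
    show "lattice A" "lattice L"
      by (rule lattice_axioms L.lattice_axioms)+
    show "prime_embed A \<in> carrier A \<rightarrow>\<^sub>E carrier L"
      by (simp add: PiE_iff L.carrier_eq prime_embed_closed) (simp add: prime_embed_def)
    show "prime_embed A \<top> = \<top>\<^bsub>L\<^esub>"
      using prime_filter_top by (auto simp: L.top_eq_carrier prime_embed_apply)
    show "prime_embed A \<bottom> = \<bottom>\<^bsub>L\<^esub>"
      using prime_filter_bottom by (auto simp: L.bottom_eq_empty prime_embed_apply)
  next
    fix a assume "a \<in> carrier A"
    then show "prime_embed A (nabla A a) = nabla L (prime_embed A a)"
      by (simp add: L.nabla_eq prime_embed_nabla)
  next
    fix a b assume ab: "a \<in> carrier A" "b \<in> carrier A"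
    then have "prime_embed A a \<sqinter>\<^bsub>L\<^esub> prime_embed A b = prime_embed A a \<inter> prime_embed A b"
      "prime_embed A a \<squnion>\<^bsub>L\<^esub> prime_embed A b = prime_embed A a \<union> prime_embed A b"
      by (simp_all add: L.meet_eq L.join_eq prime_embed_closed)
    then show "prime_embed A (a \<sqinter> b) = prime_embed A a \<sqinter>\<^bsub>L\<^esub> prime_embed A b"
      "prime_embed A (a \<squnion> b) = prime_embed A a \<squnion>\<^bsub>L\<^esub> prime_embed A b"
      using ab prime_filter_meet_iff prime_filter_join_iff by (auto simp: prime_embed_apply)
    show "prime_embed A (arrow A a b) = arrow L (prime_embed A a) (prime_embed A b)"
      using ab by (simp add: L.arrow_eq prime_embed_arrow)
  qed
qed

end

text \<open>The argument for \<open>arrow\<close> with inclusion as the relation: a prime filter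
  above \<open>P\<close> containing \<open>a\<close> but not \<open>b\<close> is obstructed only by
  \<open>p \<sqinter> a \<sqsubseteq> b\<close>, that is, by
  \<open>p \<sqsubseteq> himp A a b\<close>.\<close>

lemma (in heyting_nabla_algebra) prime_embed_himp:
  assumes ab: "a \<in> carrier A" "b \<in> carrier A"
  shows "prime_embed A (himp A a b) =
    upset_himp (prime_frame A) (prime_embed A a) (prime_embed A b)"
proof (intro equalityI subsetI)
  fix P assume "P \<in> prime_embed A (himp A a b)"
  then have P: "P \<in> prime_filters A" "himp A a b \<in> P"
    using ab by (simp_all add: prime_embed_apply himp_closed)
  have "b \<in> Q" if Q: "Q \<in> prime_filters A" "a \<in> Q" "P \<subseteq> Q" for Q
  proof -
    have "himp A a b \<sqinter> a \<in> Q"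
      using P(2) Q by (intro prime_filter_meet[OF Q(1)]) auto
    moreover have "himp A a b \<sqinter> a \<sqsubseteq> b"
      using ab by (simp add: himp_residuation himp_closed)
    ultimately show ?thesis
      using prime_filter_up[OF Q(1)] ab by blast
  qed
  then show "P \<in> upset_himp (prime_frame A) (prime_embed A a) (prime_embed A b)"
    using P ab by (simp add: upset_himp_def prime_embed_apply)
next
  fix P assume "P \<in> upset_himp (prime_frame A) (prime_embed A a) (prime_embed A b)"
  then have P: "P \<in> prime_filters A"
    and imp: "\<And>Q. Q \<in> prime_filters A \<Longrightarrow> a \<in> Q \<Longrightarrow> P \<subseteq> Q \<Longrightarrow> b \<in> Q"
    using ab by (auto simp: upset_himp_def prime_embed_apply)
  let ?S = "{s \<sqinter> t | s t. s \<in> P \<and> t \<in> {a}}"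
  have "himp A a b \<in> P"
  proof (rule ccontr)
    assume notin: "himp A a b \<notin> P"
    have down: "down_directed A ?S"
      using down_directed_meets[OF down_directed_filter[OF prime_filter_is_filter[OF P]]
          down_directed_singleton[OF ab(1)]] .
    have sep: "\<not> s \<sqsubseteq> t" if st: "s \<in> ?S" "t \<in> {b}" for s t
    proof
      assume "s \<sqsubseteq> t"
      then obtain p where p: "p \<in> P" "p \<sqinter> a \<sqsubseteq> b"
        using st by blast
      then have "p \<sqsubseteq> himp A a b"
        using ab prime_filter_carrier[OF P] by (simp add: himp_residuation)
      then show False
        using prime_filter_up[OF P p(1)] notin ab himp_closed by blast
    qed
    obtain Q where Q: "Q \<in> prime_filters A" "?S \<subseteq> Q" "Q \<inter> {b} = {}"
      using prime_separation[OF down up_directed_singleton[OF ab(2)] sep] by blast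
    have mem: "p \<in> Q \<and> a \<in> Q" if "p \<in> P" for p
    proof -
      have "p \<sqinter> a \<in> Q"
        using Q(2) that by blast
      then show ?thesis
        using prime_filter_meet_iff[OF Q(1)] ab prime_filter_carrier[OF P that] by simp
    qed
    then have "b \<in> Q"
      using imp Q(1) prime_filter_top[OF P] by blast
    then show False
      using Q(3) by blast
  qed
  then show "P \<in> prime_embed A (himp A a b)"
    using P ab by (simp add: prime_embed_apply himp_closed)
qed

lemma (in heyting_nabla_algebra) prime_embed_heyting_nabla_hom:
  "prime_embed A \<in> heyting_nabla_hom A (upset_alg_H (prime_frame A))"
  using prime_embed_nabla_hom[OF upset_nabla_algebra_upset_alg_H[OF kripke_frame_prime_frame]]
    prime_embed_himp
  by (simp add: heyting_nabla_hom_def upset_alg_H_def)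

text \<open>At \<open>a\<close> both sides are the set of prime filters of \<open>B\<close>
  containing \<open>f a\<close>; off the carrier both composites take the same default
  value.\<close>

lemma prime_embed_natural:
  assumes "bounded_lattice A" "bounded_lattice B" and f: "f \<in> nabla_hom A B"
  shows "compose (carrier A)
      (upset_map (prime_frame B) (prime_frame A) (prime_map A B f)) (prime_embed A) =
    compose (carrier A) (prime_embed B) f"
proof (rule ext)
  fix a
  show "compose (carrier A) (upset_map (prime_frame B) (prime_frame A) (prime_map A B f))
      (prime_embed A) a = compose (carrier A) (prime_embed B) f a"
  proof (cases "a \<in> carrier A")
    case True
    have "prime_map A B f -` prime_embed A a \<inter> prime_filters B = prime_embed B (f a)"
      using True prime_map_closed[OF assms] nabla_hom_closed[OF f]
      by (auto simp: prime_embed_apply prime_map_apply)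
    then show ?thesis
      using True by (simp add: compose_eq upset_map_def prime_embed_closed)
  qed (simp add: compose_def)
qed

section \<open>Categories and functoriality\<close>

text \<open>All four categories consist of extensional maps under restricted composition, so the
  unit and associativity laws hold as equalities of functions. What remains for each is that
  identities and composites are morphisms. The parameter \<open>car\<close> absorbs the different
  record types.\<close>

lemma is_category_concrete:
  assumes "\<And>X Y f. X \<in> Ob \<Longrightarrow> Y \<in> Ob \<Longrightarrow> f \<in> H X Y \<Longrightarrow> f \<in> car X \<rightarrow>\<^sub>E car Y"
    and "\<And>X. X \<in> Ob \<Longrightarrow> (\<lambda>x\<in>car X. x) \<in> H X X"
    and "\<And>X Y Z f g. X \<in> Ob \<Longrightarrow> Y \<in> Ob \<Longrightarrow> Z \<in> Ob \<Longrightarrow> f \<in> H X Y \<Longrightarrow> g \<in> H Y Z \<Longrightarrow>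
      compose (car X) g f \<in> H X Z"
  shows "is_category \<lparr>cat_ob = Ob, cat_hom = H, cat_id = (\<lambda>X. \<lambda>x\<in>car X. x),
    cat_comp = (\<lambda>X Y Z g f. compose (car X) g f)\<rparr>"
proof -
  have unit: "compose (car X) f (\<lambda>x\<in>car X. x) = f \<and> compose (car X) (\<lambda>y\<in>car Y. y) f = f"
    if "X \<in> Ob" "Y \<in> Ob" "f \<in> H X Y" for X Y f
    using assms(1)[OF that] by (auto simp: PiE_def compose_Id Id_compose)
  have assoc: "compose (car X) h (compose (car X) g f) = compose (car X) (compose (car Y) h g) f"
    if "X \<in> Ob" "Y \<in> Ob" "f \<in> H X Y" for X Y f g h
    using assms(1)[OF that] by (intro compose_assoc[symmetric] | auto simp: compose_def fun_eq_iff)+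
  show ?thesis
    unfolding is_category_def cat.simps
    by (intro conjI ballI) (simp_all add: assms(2,3) unit assoc)
qed

lemma is_category_opposite: "is_category C \<Longrightarrow> is_category (opposite C)"
  unfolding is_category_def opposite_def cat.simps by (intro conjI ballI; elim conjE; simp)

lemma nabla_hom_id:
  assumes "nabla_algebra A"
  shows "(\<lambda>a\<in>carrier A. a) \<in> nabla_hom A A"
proof -
  interpret nabla_algebra A by fact
  show ?thesis
    by (rule nabla_homI) (simp_all add: lattice_axioms nabla_closed arrow_closed)
qed

lemma nabla_hom_compose:
  assumes "nabla_algebra A" "nabla_algebra D" and f: "f \<in> nabla_hom A B" and g: "g \<in> nabla_hom B D"
  shows "compose (carrier A) g f \<in> nabla_hom A D"
proof -
  interpret A: nabla_algebra A by fact
  interpret D: nabla_algebra D by fact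
  show ?thesis
  proof (rule nabla_homI)
    show "compose (carrier A) g f \<in> carrier A \<rightarrow>\<^sub>E carrier D"
      using nabla_hom_closed[OF f] nabla_hom_closed[OF g] by (simp add: compose_def)
  qed (simp_all add: A.lattice_axioms D.lattice_axioms A.nabla_closed A.arrow_closed compose_eq
      nabla_hom_closed[OF f] nabla_hom_meet[OF f] nabla_hom_join[OF f] nabla_hom_top[OF f]
      nabla_hom_bottom[OF f] nabla_hom_nabla[OF f] nabla_hom_arrow[OF f]
      nabla_hom_meet[OF g] nabla_hom_join[OF g] nabla_hom_top[OF g]
      nabla_hom_bottom[OF g] nabla_hom_nabla[OF g] nabla_hom_arrow[OF g])
qed

lemma heyting_nabla_hom_id:
  assumes "heyting_nabla_algebra A"
  shows "(\<lambda>a\<in>carrier A. a) \<in> heyting_nabla_hom A A"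
proof -
  interpret heyting_nabla_algebra A by fact
  show ?thesis
    using nabla_hom_id[OF nabla_algebra_axioms] by (simp add: heyting_nabla_hom_def himp_closed)
qed

lemma heyting_nabla_hom_compose:
  assumes "heyting_nabla_algebra A" "heyting_nabla_algebra D"
    and f: "f \<in> heyting_nabla_hom A B" and g: "g \<in> heyting_nabla_hom B D"
  shows "compose (carrier A) g f \<in> heyting_nabla_hom A D"
proof -
  interpret A: heyting_nabla_algebra A by fact
  interpret D: heyting_nabla_algebra D by fact
  have fg: "f \<in> nabla_hom A B" "g \<in> nabla_hom B D"
    using f g by (simp_all add: heyting_nabla_hom_def)
  show ?thesis
    using f g nabla_hom_compose[OF A.nabla_algebra_axioms D.nabla_algebra_axioms fg]
      nabla_hom_closed[OF fg(1)]
    by (simp add: heyting_nabla_hom_def compose_eq A.himp_closed)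
qed

lemma kripke_hom_id:
  assumes "kripke_frame K"
  shows "(\<lambda>k\<in>carrier K. k) \<in> kripke_hom K K"
proof -
  interpret kripke_frame K by fact
  have "isotone K K (\<lambda>k\<in>carrier K. k)"
    by (intro isotoneI weak_partial_order_axioms) simp
  then show ?thesis
    using acc_subset unfolding kripke_hom_def by auto
qed

lemma kripke_hom_compose:
  assumes "kripke_frame K" "kripke_frame L" "kripke_frame M"
    and f: "f \<in> kripke_hom K L" and g: "g \<in> kripke_hom L M"
  shows "compose (carrier K) g f \<in> kripke_hom K M"
proof -
  interpret K: kripke_frame K by fact
  interpret L: kripke_frame L by fact
  interpret M: kripke_frame M by fact
  note f = kripke_homD[OF f] and g = kripke_homD[OF g]
  let ?h = "compose (carrier K) g f"
  have app: "?h k = g (f k)" if "k \<in> carrier K" for k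
    using that by (simp add: compose_eq)
  have "?h \<in> carrier K \<rightarrow>\<^sub>E carrier M"
    using f(2) g(2) by (auto simp: compose_def)
  moreover have "isotone K M ?h"
    using f(2) use_iso2[OF f(3)] use_iso2[OF g(3)]
    by (intro isotoneI K.weak_partial_order_axioms M.weak_partial_order_axioms) (simp add: app)
  moreover have "(?h k, ?h l) \<in> acc M" if "(k, l) \<in> acc K" for k l
  proof -
    have "k \<in> carrier K" "l \<in> carrier K"
      using that K.acc_subset by auto
    then show ?thesis
      using f(4)[OF that] g(4) by (simp add: app)
  qed
  moreover have "\<exists>l\<in>carrier K. (k, l) \<in> acc K \<and> ?h l = l'"
    if k: "k \<in> carrier K" and l': "l' \<in> carrier M" "(?h k, l') \<in> acc M" for k l'
  proof -
    obtain m where m: "m \<in> carrier L" "(f k, m) \<in> acc L" "g m = l'"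
      using g(5)[of "f k" l'] f(2)[OF k] l' k by (auto simp: app)
    then obtain l where "l \<in> carrier K" "(k, l) \<in> acc K" "f l = m"
      using f(5)[OF k] by blast
    then show ?thesis
      using m by (auto simp: app)
  qed
  moreover have "\<exists>l\<in>carrier K. (l, k) \<in> acc K \<and> l' \<sqsubseteq>\<^bsub>M\<^esub> ?h l"
    if k: "k \<in> carrier K" and l': "l' \<in> carrier M" "(l', ?h k) \<in> acc M" for k l'
  proof -
    obtain m where m: "m \<in> carrier L" "(m, f k) \<in> acc L" "l' \<sqsubseteq>\<^bsub>M\<^esub> g m"
      using g(6)[of "f k" l'] f(2)[OF k] l' k by (auto simp: app)
    then obtain l where l: "l \<in> carrier K" "(l, k) \<in> acc K" "m \<sqsubseteq>\<^bsub>L\<^esub> f l"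
      using f(6)[OF k] by blast
    \<comment> \<open>Lifting of predecessors yields only inequalities; isotonicity of
      \<open>g\<close> is what chains \<open>l' \<sqsubseteq> g m\<close> with
      \<open>m \<sqsubseteq> f l\<close>.\<close>
    then have "g m \<sqsubseteq>\<^bsub>M\<^esub> g (f l)"
      using use_iso2[OF g(3)] m f(2) by blast
    then have "l' \<sqsubseteq>\<^bsub>M\<^esub> ?h l"
      using M.le_trans[OF m(3)] l l' m f(2) g(2) by (simp add: app)
    then show ?thesis
      using l by blast
  qed
  ultimately show ?thesis
    unfolding kripke_hom_def by blast
qed

lemma heyting_kripke_hom_id:
  assumes "kripke_frame K"
  shows "(\<lambda>k\<in>carrier K. k) \<in> heyting_kripke_hom K K"
  using kripke_hom_id[OF assms] by (auto simp: heyting_kripke_hom_def)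

lemma heyting_kripke_hom_compose:
  assumes "kripke_frame K" "kripke_frame L" "kripke_frame M"
    and f: "f \<in> heyting_kripke_hom K L" and g: "g \<in> heyting_kripke_hom L M"
  shows "compose (carrier K) g f \<in> heyting_kripke_hom K M"
proof -
  have fg: "f \<in> kripke_hom K L" "g \<in> kripke_hom L M"
    using f g by (simp_all add: heyting_kripke_hom_def)
  have "\<exists>l\<in>carrier K. k \<sqsubseteq>\<^bsub>K\<^esub> l \<and> compose (carrier K) g f l = l'"
    if k: "k \<in> carrier K" and l': "l' \<in> carrier M" "compose (carrier K) g f k \<sqsubseteq>\<^bsub>M\<^esub> l'" for k l'
  proof -
    have "g (f k) \<sqsubseteq>\<^bsub>M\<^esub> l'" "f k \<in> carrier L"
      using k l' kripke_hom_closed[OF fg(1)] by (simp_all add: compose_eq)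
    then obtain m where m: "m \<in> carrier L" "f k \<sqsubseteq>\<^bsub>L\<^esub> m" "g m = l'"
      using g l' unfolding heyting_kripke_hom_def by blast
    then obtain l where "l \<in> carrier K" "k \<sqsubseteq>\<^bsub>K\<^esub> l" "f l = m"
      using f k unfolding heyting_kripke_hom_def by blast
    then show ?thesis
      using m by (auto simp: compose_eq)
  qed
  then show ?thesis
    using kripke_hom_compose[OF assms(1-3) fg] by (simp add: heyting_kripke_hom_def)
qed

lemma is_category_Alg_nabla: "is_category (Alg_nabla C)"
  unfolding Alg_nabla_def
  by (rule is_category_concrete)
    (auto simp: distributive_nabla_algebra_def nabla_hom_funcset nabla_hom_id intro: nabla_hom_compose)

lemma is_category_Alg_nabla_H: "is_category (Alg_nabla_H C)"
  unfolding Alg_nabla_H_def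
proof (rule is_category_concrete)
  show "f \<in> carrier X \<rightarrow>\<^sub>E carrier Y" if "f \<in> heyting_nabla_hom X Y" for X Y f
    using that nabla_hom_funcset[of f X Y] by (simp add: heyting_nabla_hom_def)
qed (auto simp: heyting_nabla_hom_id intro: heyting_nabla_hom_compose)

lemma is_category_Kripke: "is_category (Kripke C)"
  unfolding Kripke_def
  by (rule is_category_concrete) (auto simp: kripke_hom_funcset kripke_hom_id intro: kripke_hom_compose)

lemma is_category_Kripke_H: "is_category (Kripke_H C)"
  unfolding Kripke_H_def
proof (rule is_category_concrete)
  show "f \<in> carrier X \<rightarrow>\<^sub>E carrier Y" if "f \<in> heyting_kripke_hom X Y" for X Y f
    using that kripke_hom_funcset[of f X Y] by (simp add: heyting_kripke_hom_def)
qed (auto simp: heyting_kripke_hom_id intro: heyting_kripke_hom_compose)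

section \<open>Functoriality of the prime filter construction\<close>

lemma prime_map_id: "prime_map A A (\<lambda>a\<in>carrier A. a) = (\<lambda>P\<in>prime_filters A. P)"
  unfolding prime_map_def
  by (rule restrict_ext) (auto dest: prime_filter_carrier)

lemma prime_map_compose:
  assumes "bounded_lattice B" "bounded_lattice D" and f: "f \<in> nabla_hom A B" and g: "g \<in> nabla_hom B D"
  shows "prime_map A D (compose (carrier A) g f) =
    compose (prime_filters D) (prime_map A B f) (prime_map B D g)"
  unfolding compose_def prime_map_def[of A D]
proof (rule restrict_ext)
  fix P assume P: "P \<in> prime_filters D"
  then show "(\<lambda>x\<in>carrier A. g (f x)) -` P \<inter> carrier A = prime_map A B f (prime_map B D g P)"
    using prime_map_closed[OF assms(1,2) g P] nabla_hom_closed[OF f] by (auto simp: prime_map_apply)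
qed

lemma distributive_nabla_algebraD:
  assumes "distributive_nabla_algebra A"
  shows distributive_nabla_algebra_nabla: "nabla_algebra A"
    and distributive_nabla_algebra_lattice: "bounded_lattice A"
  using assms by (simp_all add: distributive_nabla_algebra_def nabla_algebra_def)

lemma heyting_nabla_algebra_distributive:
  assumes "heyting_nabla_algebra A"
  shows "distributive_nabla_algebra A"
proof -
  interpret heyting_nabla_algebra A by fact
  show ?thesis
    by unfold_locales
qed

lemma prime_frame_ob:
  assumes "distributive_nabla_algebra A"
  shows kripke_frame_prime: "kripke_frame (prime_frame A)"
    and frame_cond_prime: "alg_cond A c \<Longrightarrow> frame_cond (prime_frame A) c"
  using assms distributive_nabla_algebra.frame_cond_prime_frame[OF assms]
  by (simp_all add: nabla_algebra.kripke_frame_prime_frame distributive_nabla_algebra_nabla)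

text \<open>The conditions in \<open>C\<close> restrict objects only, so the part on morphisms is
  the same for every \<open>C\<close> and \<open>frame_cond_prime\<close> supplies the rest.\<close>

lemma is_functor_prime:
  "is_functor (Alg_nabla C :: ('a nabla_algebra, 'a \<Rightarrow> 'a) cat) (opposite (Kripke C)) prime_frame prime_map"
proof -
  have "prime_map X Z (compose (carrier X) g f) =
      compose (prime_filters Z) (prime_map X Y f) (prime_map Y Z g)"
    if "distributive_nabla_algebra Y" "distributive_nabla_algebra Z"
      "f \<in> nabla_hom X Y" "g \<in> nabla_hom Y Z" for X Y Z :: "'a nabla_algebra" and f g
    using that by (intro prime_map_compose distributive_nabla_algebra_lattice)
  moreover have "prime_map X Y f \<in> kripke_hom (prime_frame Y) (prime_frame X)"
    if "distributive_nabla_algebra X" "distributive_nabla_algebra Y" "f \<in> nabla_hom X Y"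
    for X Y :: "'a nabla_algebra" and f
    using that by (intro prime_map_kripke_hom distributive_nabla_algebra_nabla)
  ultimately show ?thesis
    unfolding is_functor_def
    by (simp add: is_category_Alg_nabla is_category_opposite is_category_Kripke)
      (simp add: Alg_nabla_def opposite_def Kripke_def prime_map_id prime_frame_ob)
qed

lemma is_functor_prime_H:
  "is_functor (Alg_nabla_H C :: ('a heyting_nabla_algebra, 'a \<Rightarrow> 'a) cat) (opposite (Kripke_H C)) prime_frame prime_map"
proof -
  have "prime_map X Z (compose (carrier X) g f) =
      compose (prime_filters Z) (prime_map X Y f) (prime_map Y Z g)"
    if "heyting_nabla_algebra Y" "heyting_nabla_algebra Z"
      "f \<in> heyting_nabla_hom X Y" "g \<in> heyting_nabla_hom Y Z"
    for X Y Z :: "'a heyting_nabla_algebra" and f g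
    using that
    by (intro prime_map_compose distributive_nabla_algebra_lattice heyting_nabla_algebra_distributive)
      (simp_all add: heyting_nabla_hom_def)
  then show ?thesis
    unfolding is_functor_def
    by (simp add: is_category_Alg_nabla_H is_category_opposite is_category_Kripke_H)
      (simp add: Alg_nabla_H_def opposite_def Kripke_H_def prime_map_id prime_frame_ob
        heyting_nabla_algebra_distributive prime_map_heyting_kripke_hom)
qed

text \<open>A category here has a single type of objects and of arrows, so functoriality speaks of
  algebras over one type \<open>'a\<close>. The naturality square is stated for algebras over two
  types \<open>'a\<close> and \<open>'b\<close>, together with the fact that its vertical maps are
  morphisms.\<close>

theorem theorem6p6:
  shows
    "is_functor (Alg_nabla {} :: ('a nabla_algebra, 'a \<Rightarrow> 'a) cat) (opposite (Kripke {}))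
       prime_frame prime_map
     \<and> (\<forall>A :: 'a nabla_algebra. distributive_nabla_algebra A \<longrightarrow>
          distributive_nabla_algebra (upset_alg (prime_frame A)) \<and>
          prime_embed A \<in> nabla_embedding A (upset_alg (prime_frame A)))
     \<and> (\<forall>(A :: 'a nabla_algebra) (B :: 'b nabla_algebra) f.
          distributive_nabla_algebra A \<and> distributive_nabla_algebra B \<and> f \<in> nabla_hom A B \<longrightarrow>
          prime_map A B f \<in> kripke_hom (prime_frame B) (prime_frame A) \<and>
          upset_map (prime_frame B) (prime_frame A) (prime_map A B f)
            \<in> nabla_hom (upset_alg (prime_frame A)) (upset_alg (prime_frame B)) \<and>
          compose (carrier A)
            (upset_map (prime_frame B) (prime_frame A) (prime_map A B f)) (prime_embed A)
          = compose (carrier A) (prime_embed B) f)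
     \<and> (\<forall>C :: condition set.
          (\<forall>A :: 'a nabla_algebra.
             A \<in> cat_ob (Alg_nabla C) \<longrightarrow> prime_frame A \<in> cat_ob (opposite (Kripke C)))
          \<and> is_functor (Alg_nabla_H C :: ('a heyting_nabla_algebra, 'a \<Rightarrow> 'a) cat)
              (opposite (Kripke_H C)) prime_frame prime_map
          \<and> (\<forall>A :: 'a heyting_nabla_algebra.
               A \<in> cat_ob (Alg_nabla_H C) \<longrightarrow>
               heyting_nabla_algebra (upset_alg_H (prime_frame A)) \<and>
               prime_embed A \<in> heyting_nabla_hom A (upset_alg_H (prime_frame A))))"
proof (intro conjI allI impI; (elim conjE)?)
  show "is_functor (Alg_nabla {}) (opposite (Kripke {})) prime_frame prime_map"
    by (rule is_functor_prime)
next
  fix A :: "'a nabla_algebra"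
  assume "distributive_nabla_algebra A"
  then interpret distributive_nabla_algebra A .
  interpret U: upset_nabla_algebra "prime_frame A" "upset_alg (prime_frame A)"
    by (rule upset_nabla_algebra_upset_alg[OF kripke_frame_prime_frame])
  show "distributive_nabla_algebra (upset_alg (prime_frame A))"
    by (rule U.distributive_nabla_algebra)
  show "prime_embed A \<in> nabla_embedding A (upset_alg (prime_frame A))"
    using prime_embed_nabla_hom[OF U.upset_nabla_algebra_axioms] prime_embed_inj
    by (simp add: nabla_embedding_def)
next
  fix A :: "'a nabla_algebra" and B :: "'b nabla_algebra" and f
  assume "distributive_nabla_algebra A" "distributive_nabla_algebra B" and f: "f \<in> nabla_hom A B"
  then interpret A: distributive_nabla_algebra A + B: distributive_nabla_algebra B
    by simp_all
  show hom: "prime_map A B f \<in> kripke_hom (prime_frame B) (prime_frame A)"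
    by (rule prime_map_kripke_hom[OF A.nabla_algebra_axioms B.distributive_nabla_algebra_axioms f])
  show "upset_map (prime_frame B) (prime_frame A) (prime_map A B f)
      \<in> nabla_hom (upset_alg (prime_frame A)) (upset_alg (prime_frame B))"
    by (intro upset_map_nabla_hom upset_nabla_algebra_upset_alg A.kripke_frame_prime_frame
        B.kripke_frame_prime_frame hom)
  show "compose (carrier A)
      (upset_map (prime_frame B) (prime_frame A) (prime_map A B f)) (prime_embed A)
      = compose (carrier A) (prime_embed B) f"
    by (rule prime_embed_natural[OF A.bounded_lattice_axioms B.bounded_lattice_axioms f])
next
  fix C and A :: "'a nabla_algebra"
  assume "A \<in> cat_ob (Alg_nabla C)"
  then show "prime_frame A \<in> cat_ob (opposite (Kripke C))"
    by (simp add: Alg_nabla_def opposite_def Kripke_def prime_frame_ob)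
next
  fix C
  show "is_functor (Alg_nabla_H C :: ('a heyting_nabla_algebra, 'a \<Rightarrow> 'a) cat)
      (opposite (Kripke_H C)) prime_frame prime_map"
    by (rule is_functor_prime_H)
next
  fix C and A :: "'a heyting_nabla_algebra"
  assume "A \<in> cat_ob (Alg_nabla_H C)"
  then interpret heyting_nabla_algebra A
    by (simp add: Alg_nabla_H_def)
  show "heyting_nabla_algebra (upset_alg_H (prime_frame A))"
    by (rule heyting_nabla_algebra_upset_alg_H[OF kripke_frame_prime_frame])
  show "prime_embed A \<in> heyting_nabla_hom A (upset_alg_H (prime_frame A))"
    by (rule prime_embed_heyting_nabla_hom)
qed

end
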